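(* Consider online bipartite matching in the Random Order arrival model with $n$ offline and $n$ online vertices. Let $\hat c$ be any advice with $|\hat T|=\hat r$, let $\varepsilon>0$, and let $\delta>\frac{1}{\mathrm{poly}(\hat r)}$, split as $\delta=\delta'+\delta_{poi}$. Let $\hat L_1$ be the estimate of $L_1(p^*,q)$ computed by TestAndMatch from the first $k=s\cdot\sqrt{\log(\hat r+1)}$ arrivals (which provide IID samples of $p^*$), where $s=s_{\hat r,\varepsilon,\delta}$. Then with probability at least $1-\delta$ the tester in TestAndMatch succeeds, and when it succeeds, the matching of size $m$ produced by TestAndMatch satisfies the following. (1) If $\hat L_1\le 2\left(\frac{\hat n}{n}-\beta\right)-\varepsilon$, then its competitive ratio is at least $\frac{\hat n}{n}-\frac{L_1(p^*,q)}{2}\ge\beta$; that is, $\frac{m}{n^*}\ge \frac{\hat n}{n}-\frac{L_1(p^*,q)}{2}\ge \beta$. (2) Otherwise, its competitive ratio is at least $\beta\cdot\left(1-\frac{k}{n}\right)$; that is, the expected size of the produced matching in this case is at least $\beta\left(1-\frac{k}{n}\right)n^*$.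
   Context: Problem. $\mathcal{G}^*=(U\cup V,E)$ is a bipartite graph with $|U|=|V|=n$ and maximum matching size $n^*\le n$, chosen by an adversary. In the Random Order model the online vertices $V$ arrive in uniformly random order. When $v$ arrives, its type (its neighborhood, an element of $2^U$) is revealed, and the algorithm irrevocably leaves $v$ unmatched or matches it to an unmatched neighbor. The competitive ratio is the expected number of matches divided by $n^*$, expectations being over the random arrival order and internal randomness. Baseline is a fixed advice-free online algorithm with competitive ratio $\beta<1$ in this model. Type counts and advice. For $t\in 2^U$, $c^*(t)$ is the number of online vertices of type $t$ in $\mathcal{G}^*$. The advice is $\hat c:2^U\to\mathbb{Z}_{\ge0}$ with $\sum_t\hat c(t)=n$; $\hat T$ is its support and $\hat r=|\hat T|$. The advice defines a graph $\hat{\mathcal{G}}$ on $U$ and $n$ online vertices, having $\hat c(t)$ vertices of type $t$; $\hat M$ is a fixed maximum matching of $\hat{\mathcal{G}}$ and $\hat n$ is its size. Put $p^*=c^*/n$, $q=\hat c/n$, and $L_1(x,y)=\sum_t|x(t)-y(t)|$. Mimic. When a vertex of type $t$ arrives, if some type-$t$ online vertex of $\hat{\mathcal{G}}$ has not yet been used, pick an arbitrary unused one, mark it used, and match the arriving vertex to its partner in $\hat M$ (if it has one); otherwise leave the arriving vertex unmatched. Estimator (known result, used as a black box). For a known distribution $q$ on a domain of size $r$, error $\varepsilon>0$ and failure rate $\delta'$, there is an even integer $s\in O\!\left(\frac{r\log(1/\delta')}{\varepsilon^2\log r}\right)$ and an algorithm that draws $s_1+s_2$ IID samples from an unknown distribution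 $p$ on the domain, where $s_1,s_2\sim\mathrm{Poisson}(s/2)$ are independent, and outputs $\hat L_1$ with $|\hat L_1-L_1(p,q)|\le\varepsilon$ with probability at least $1-\delta'$. It is applied here on the domain $\hat T\cup\{t_0\}$ of size $\hat r+1$, where $t_0$ is a dummy type with $q(t_0)=0$ and every arrival whose type is not in $\hat T$ is relabelled $t_0$ (this preserves $L_1(p^*,q)$); the corresponding value of $s$ is $s_{\hat r,\varepsilon,\delta}=O\!\left(\frac{(\hat r+1)\log(1/\delta')}{\varepsilon^2\log(\hat r+1)}\right)$. Failure parameters. $\delta=\delta'+\delta_{poi}$ with $\delta'>0$, where $\delta_{poi}=O(1/\mathrm{poly}(\hat r))$ bounds the probability that a $\mathrm{Poisson}(s)$ variable exceeds $s\sqrt{\log(\hat r+1)}$. Algorithm TestAndMatch. Compute $\hat M$. If $\hat n/n\le\beta$, run Baseline on all arrivals (no test is performed, and this counts as the second case). Otherwise set $\tau=2(\hat n/n-\beta)-\varepsilon$ and run Mimic on the first $k=s\sqrt{\log(\hat r+1)}$ arrivals (implicitly $k\le n$), storing them in a list $A$. Then run the tester: draw $s_1,s_2\sim\mathrm{Poisson}(s/2)$ independently; if $s_1+s_2>s\sqrt{\log(\hat r+1)}$, output "Fail"; otherwise obtain $s_1+s_2$ IID samples from $p^*$ from the arrivals in $A$, compute $\hat L_1$ with the estimator, and pass if and only if $\hat L_1\le\tau$. The IID samples are obtained by repeating the following: if $i$ arrivals of $A$ have been used so far, then with probability $i/n$ output a uniformly random one of these $i$ arrivals, and otherwise output the next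 arrival of $A$. If the tester passes, run Mimic on the remaining arrivals; otherwise run Baseline on the remaining arrivals (with the still-unmatched offline vertices). The tester succeeds if it does not output "Fail" and $|\hat L_1-L_1(p^*,q)|\le\varepsilon$ (vacuously if no test is performed).
   Formalization: In (2), conditioning on the verdict can bias the first k arrivals, so the bound is proved for the branch taken over a fresh random order, plus a conditional bound by β times the expected optimum on later arrivals; Baseline's ratio β is assumed on all instances with at most as many online as offline vertices. *)

theory Defs
  imports
    "HOL-Probability.Probability"
    "HOL-Combinatorics.Multiset_Permutations"
    "HOL-Library.Landau_Symbols"
    "HOL-Computational_Algebra.Polynomial"
begin

section \<open>Bipartite graphs and matchings\<close>

text \<open>A bipartite graph is given by its set of edges \<open>(u, v)\<close>, with \<open>u\<close> offline and \<open>v\<close> online.\<close>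

definition nbhd :: "('u \<times> 'v) set \<Rightarrow> 'v \<Rightarrow> 'u set" where
  "nbhd E v = {u. (u, v) \<in> E}"

definition is_matching :: "('u \<times> 'v) set \<Rightarrow> ('u \<times> 'v) set \<Rightarrow> bool" where
  "is_matching E M \<longleftrightarrow> M \<subseteq> E \<and> inj_on fst M \<and> inj_on snd M"

definition max_matching_size :: "('u \<times> 'v) set \<Rightarrow> nat" where
  "max_matching_size E = Max (card ` {M. is_matching E M})"

definition is_max_matching :: "('u \<times> 'v) set \<Rightarrow> ('u \<times> 'v) set \<Rightarrow> bool" where
  "is_max_matching E M \<longleftrightarrow> is_matching E M \<and> (\<forall>M'. is_matching E M' \<longrightarrow> card M' \<le> card M)"

section \<open>Type counts and advice\<close>

definition type_count :: "('u \<times> 'v) set \<Rightarrow> 'v set \<Rightarrow> 'u set \<Rightarrow> nat" where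
  "type_count E V t = card {v \<in> V. nbhd E v = t}"

definition L1 :: "'d set \<Rightarrow> ('d \<Rightarrow> real) \<Rightarrow> ('d \<Rightarrow> real) \<Rightarrow> real" where
  "L1 D x y = (\<Sum>t\<in>D. \<bar>x t - y t\<bar>)"

definition advice_support :: "('u set \<Rightarrow> nat) \<Rightarrow> 'u set set" where
  "advice_support c = {t. c t > 0}"

text \<open>The \<open>c t\<close> online vertices of type \<open>t\<close> in the advice graph are the pairs \<open>(t, i)\<close> with
  \<open>i < c t\<close>.\<close>

definition advice_vertices :: "('u set \<Rightarrow> nat) \<Rightarrow> ('u set \<times> nat) set" where
  "advice_vertices c = {(t, i). i < c t}"

definition advice_edges :: "('u set \<Rightarrow> nat) \<Rightarrow> ('u \<times> ('u set \<times> nat)) set" where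
  "advice_edges c = {(u, w). w \<in> advice_vertices c \<and> u \<in> fst w}"

section \<open>Online algorithms in the random order model\<close>

text \<open>A randomised online algorithm maps the set of offline vertices, the number of arrivals, the
  past (types that arrived, with the decisions taken) and the current type to the distribution of
  the next decision: \<open>None\<close> leaves the arrival unmatched, \<open>Some u\<close> matches it to \<open>u\<close>.\<close>

type_synonym 'u online_alg =
  "'u set \<Rightarrow> nat \<Rightarrow> ('u set \<times> 'u option) list \<Rightarrow> 'u set \<Rightarrow> 'u option pmf"

definition admissible :: "'u online_alg \<Rightarrow> bool" where
  "admissible B \<longleftrightarrow> (\<forall>U N h t. set_pmf (B U N h t)
     \<subseteq> insert None (Some ` {u \<in> t. \<forall>t'. (t', Some u) \<notin> set h}))"

text \<open>Types are intersected with the offline set \<open>U\<close>, so that the algorithm can be run on the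
  offline vertices that are still unmatched.\<close>

primrec run_from ::
  "'u online_alg \<Rightarrow> 'u set \<Rightarrow> nat \<Rightarrow> ('u \<times> 'v) set \<Rightarrow> 'v list \<Rightarrow> ('u set \<times> 'u option) list
     \<Rightarrow> ('u \<times> 'v) set pmf" where
  "run_from B U N E [] h = return_pmf {}"
| "run_from B U N E (v # vs) h = do {
     let t = nbhd E v \<inter> U;
     x \<leftarrow> B U N h t;
     M \<leftarrow> run_from B U N E vs (h @ [(t, x)]);
     return_pmf (case x of None \<Rightarrow> M | Some u \<Rightarrow> insert (u, v) M)
   }"

definition run_alg ::
  "'u online_alg \<Rightarrow> 'u set \<Rightarrow> ('u \<times> 'v) set \<Rightarrow> 'v list \<Rightarrow> ('u \<times> 'v) set pmf" where
  "run_alg B U E vs = run_from B U (length vs) E vs []"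

definition random_order :: "'v set \<Rightarrow> 'v list pmf" where
  "random_order V = pmf_of_set (permutations_of_set V)"

definition expected_size :: "('u \<times> 'v) set pmf \<Rightarrow> real" where
  "expected_size P = measure_pmf.expectation P (\<lambda>M. real (card M))"

section \<open>Mimic\<close>

text \<open>The state consists of the types that arrived so far, the used advice vertices and the
  matching. \<open>pick\<close> is the arbitrary choice of an unused advice vertex of the arriving type; it may
  depend on the past.\<close>

definition mimic_step ::
  "('u set list \<Rightarrow> ('u set \<times> nat) set \<Rightarrow> 'u set \<times> nat) \<Rightarrow> ('u set \<Rightarrow> nat)
     \<Rightarrow> ('u \<times> ('u set \<times> nat)) set \<Rightarrow> ('u \<times> 'v) set \<Rightarrow> 'v
     \<Rightarrow> 'u set list \<times> ('u set \<times> nat) set \<times> ('u \<times> 'v) set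
     \<Rightarrow> 'u set list \<times> ('u set \<times> nat) set \<times> ('u \<times> 'v) set" where
  "mimic_step pick c Mhat E v = (\<lambda>(h, used, M).
     let t = nbhd E v;
         C = {w \<in> advice_vertices c. fst w = t \<and> w \<notin> used};
         w = pick h C
     in if C = {} then (h @ [t], used, M)
        else (h @ [t], insert w used, M \<union> {(u, v) |u. (u, w) \<in> Mhat}))"

definition mimic ::
  "('u set list \<Rightarrow> ('u set \<times> nat) set \<Rightarrow> 'u set \<times> nat) \<Rightarrow> ('u set \<Rightarrow> nat)
     \<Rightarrow> ('u \<times> ('u set \<times> nat)) set \<Rightarrow> ('u \<times> 'v) set \<Rightarrow> 'v list \<Rightarrow> ('u \<times> 'v) set" where
  "mimic pick c Mhat E vs = snd (snd (fold (mimic_step pick c Mhat E) vs ([], {}, {})))"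

section \<open>The estimator\<close>

text \<open>\<^const>\<open>poisson_pmf\<close> is unspecified at rate 0.\<close>

definition poisson :: "real \<Rightarrow> nat pmf" where
  "poisson rate = (if rate = 0 then return_pmf 0 else poisson_pmf rate)"

text \<open>An estimator maps the domain, the known distribution, the error, the failure rate and the
  two batches of samples to the distribution of its output.\<close>

type_synonym 'd estimator =
  "'d set \<Rightarrow> ('d \<Rightarrow> real) \<Rightarrow> real \<Rightarrow> real \<Rightarrow> 'd list \<Rightarrow> 'd list \<Rightarrow> real pmf"

definition estimate_iid :: "nat \<Rightarrow> ('d list \<Rightarrow> 'd list \<Rightarrow> real pmf) \<Rightarrow> 'd pmf \<Rightarrow> real pmf" where
  "estimate_iid s est p = do {
     s1 \<leftarrow> poisson (real s / 2);
     s2 \<leftarrow> poisson (real s / 2);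
     xs \<leftarrow> replicate_pmf s1 p;
     ys \<leftarrow> replicate_pmf s2 p;
     est xs ys
   }"

text \<open>\<open>S r \<epsilon> \<delta>\<close> is the sample size parameter for a domain of size \<open>r\<close>; the constant \<open>C\<close> is uniform
  in all parameters. Domains of size 1, where \<open>ln r = 0\<close>, are excluded.\<close>

definition L1_estimator :: "(nat \<Rightarrow> real \<Rightarrow> real \<Rightarrow> nat) \<Rightarrow> 'd estimator \<Rightarrow> bool" where
  "L1_estimator S est \<longleftrightarrow>
     (\<exists>C>0. \<forall>D q \<epsilon> \<delta>.
        finite D \<and> 2 \<le> card D \<and> (\<forall>t\<in>D. 0 \<le> q t) \<and> sum q D = 1 \<and> 0 < \<epsilon> \<and> 0 < \<delta> \<and> \<delta> < 1 \<longrightarrow>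
        even (S (card D) \<epsilon> \<delta>) \<and>
        real (S (card D) \<epsilon> \<delta>) \<le> C * (real (card D) * ln (1 / \<delta>) / (\<epsilon>\<^sup>2 * ln (real (card D)))) \<and>
        (\<forall>p. set_pmf p \<subseteq> D \<longrightarrow>
           measure_pmf.prob (estimate_iid (S (card D) \<epsilon> \<delta>) (est D q \<epsilon> \<delta>) p)
             {L. \<bar>L - L1 D (pmf p) q\<bar> \<le> \<epsilon>} \<ge> 1 - \<delta>))"

section \<open>TestAndMatch\<close>

text \<open>\<open>None\<close> is the dummy type.\<close>

definition relabel :: "('u set \<Rightarrow> nat) \<Rightarrow> 'u set \<Rightarrow> 'u set option" where
  "relabel c t = (if t \<in> advice_support c then Some t else None)"

definition test_domain :: "('u set \<Rightarrow> nat) \<Rightarrow> 'u set option set" where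
  "test_domain c = insert None (Some ` advice_support c)"

definition test_dist :: "('u set \<Rightarrow> nat) \<Rightarrow> nat \<Rightarrow> 'u set option \<Rightarrow> real" where
  "test_dist c n x = (case x of None \<Rightarrow> 0 | Some t \<Rightarrow> real (c t) / real n)"

text \<open>\<open>iid_samples n A m i\<close> draws \<open>m\<close> samples from \<open>A\<close> when \<open>i\<close> entries have been used already.\<close>

primrec iid_samples :: "nat \<Rightarrow> 'a list \<Rightarrow> nat \<Rightarrow> nat \<Rightarrow> 'a list pmf" where
  "iid_samples n A 0 i = return_pmf []"
| "iid_samples n A (Suc m) i = do {
     b \<leftarrow> bernoulli_pmf (real i / real n);
     if b then do {
       j \<leftarrow> pmf_of_set {..<i};
       xs \<leftarrow> iid_samples n A m i;
       return_pmf (A ! j # xs)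
     } else do {
       xs \<leftarrow> iid_samples n A m (Suc i);
       return_pmf (A ! i # xs)
     }
   }"

definition test_budget :: "nat \<Rightarrow> nat \<Rightarrow> real" where
  "test_budget s r = real s * sqrt (ln (real r + 1))"

text \<open>Rounding down loses nothing: \<open>s1 + s2\<close> is within the budget iff it is at most its floor.\<close>

definition test_length :: "nat \<Rightarrow> nat \<Rightarrow> nat" where
  "test_length s r = nat \<lfloor>test_budget s r\<rfloor>"

datatype test_result = NoTest | Fail | Estimate real

text \<open>\<open>A\<close> is the list of the (relabelled) types of the first arrivals.\<close>

definition run_test ::
  "nat \<Rightarrow> nat \<Rightarrow> nat \<Rightarrow> ('d list \<Rightarrow> 'd list \<Rightarrow> real pmf) \<Rightarrow> 'd list \<Rightarrow> test_result pmf" where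
  "run_test n s r est A = do {
     s1 \<leftarrow> poisson (real s / 2);
     s2 \<leftarrow> poisson (real s / 2);
     if real (s1 + s2) > test_budget s r then return_pmf Fail
     else do {
       xs \<leftarrow> iid_samples n A (s1 + s2) 0;
       map_pmf Estimate (est (take s1 xs) (drop s1 xs))
     }
   }"

fun passes :: "real \<Rightarrow> test_result \<Rightarrow> bool" where
  "passes \<tau> (Estimate L) \<longleftrightarrow> L \<le> \<tau>"
| "passes \<tau> _ \<longleftrightarrow> False"

text \<open>\<open>L\<close> is the true distance.\<close>

fun succeeds :: "real \<Rightarrow> real \<Rightarrow> test_result \<Rightarrow> bool" where
  "succeeds L \<epsilon> NoTest \<longleftrightarrow> True"
| "succeeds L \<epsilon> Fail \<longleftrightarrow> False"
| "succeeds L \<epsilon> (Estimate L') \<longleftrightarrow> \<bar>L' - L\<bar> \<le> \<epsilon>"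

text \<open>The matching produced on the arrival order \<open>vs\<close> when the result of the test on its first \<open>k\<close>
  arrivals is \<open>res\<close>.\<close>

definition matching_after ::
  "('u set list \<Rightarrow> ('u set \<times> nat) set \<Rightarrow> 'u set \<times> nat) \<Rightarrow> ('u set \<Rightarrow> nat)
     \<Rightarrow> ('u \<times> ('u set \<times> nat)) set \<Rightarrow> 'u online_alg \<Rightarrow> real \<Rightarrow> nat \<Rightarrow> 'u set \<Rightarrow> ('u \<times> 'v) set
     \<Rightarrow> test_result \<Rightarrow> 'v list \<Rightarrow> ('u \<times> 'v) set pmf" where
  "matching_after pick c Mhat B \<tau> k U E res vs =
     (if res = NoTest then run_alg B U E vs
      else if passes \<tau> res then return_pmf (mimic pick c Mhat E vs)
      else let M = mimic pick c Mhat E (take k vs)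
           in map_pmf ((\<union>) M) (run_alg B (U - fst ` M) E (drop k vs)))"

definition threshold :: "nat \<Rightarrow> nat \<Rightarrow> real \<Rightarrow> real \<Rightarrow> real" where
  "threshold nhat n \<beta> \<epsilon> = 2 * (real nhat / real n - \<beta>) - \<epsilon>"

text \<open>A run of the algorithm: the arrival order, the result of the test and the matching.\<close>

definition test_and_match ::
  "('u set list \<Rightarrow> ('u set \<times> nat) set \<Rightarrow> 'u set \<times> nat) \<Rightarrow> ('u set \<Rightarrow> nat)
     \<Rightarrow> ('u \<times> ('u set \<times> nat)) set \<Rightarrow> 'u online_alg \<Rightarrow> real \<Rightarrow> real \<Rightarrow> nat
     \<Rightarrow> ('u set option list \<Rightarrow> 'u set option list \<Rightarrow> real pmf)
     \<Rightarrow> 'u set \<Rightarrow> 'v set \<Rightarrow> ('u \<times> 'v) set \<Rightarrow> ('v list \<times> test_result \<times> ('u \<times> 'v) set) pmf" where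
  "test_and_match pick c Mhat B \<beta> \<epsilon> s est U V E = do {
     let n = card V;
     let r = card (advice_support c);
     let k = test_length s r;
     vs \<leftarrow> random_order V;
     res \<leftarrow> (if real (card Mhat) / real n \<le> \<beta> then return_pmf NoTest
            else run_test n s r est (map (\<lambda>v. relabel c (nbhd E v)) (take k vs)));
     M \<leftarrow> matching_after pick c Mhat B (threshold (card Mhat) n \<beta> \<epsilon>) k U E res vs;
     return_pmf (vs, res, M)
   }"

end

theory Submission
  imports Defs
begin

text \<open>
  The samples drawn from the first \<open>k\<close> arrivals are exactly IID: once \<open>i\<close> distinct arrivals have been
  used, the next one is uniform on the remaining \<open>n - i\<close> vertices, and reusing an old one with
  probability \<open>i / n\<close> makes the draw uniform on \<open>V\<close>. The sum of the two Poisson batch sizes is Poisson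
  of rate \<open>s\<close>, so a union bound over the estimator error and the budget overrun gives the success
  probability.

  On \<open>n\<close> arrivals of which \<open>a t\<close> have type \<open>t\<close>, Mimic uses \<open>min (a t) (c t)\<close> advice vertices of type
  \<open>t\<close> and so leaves \<open>n L / 2\<close> of them unused; each of these costs at most one edge of the advised
  matching.

  When the test is not passed, the matching \<open>M1\<close> built on the prefix destroys at most \<open>card M1\<close> edges
  of a maximum matching of the suffix. As \<open>\<beta> < 1\<close>, the edges of \<open>M1\<close> themselves make up for this
  loss, so the total is at least \<open>\<beta>\<close> times the optimum of the suffix. An edge of a maximum matching
  survives in the suffix with probability \<open>1 - k / n\<close>.
\<close>

section \<open>Expectations, random orders and IID samples\<close>

lemma expectation_bind_pmf:
  fixes g :: "'b \<Rightarrow> real"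
  assumes bound: "\<And>y. y \<in> set_pmf (p \<bind> f) \<Longrightarrow> \<bar>g y\<bar> \<le> C"
  shows "measure_pmf.expectation (p \<bind> f) g
    = measure_pmf.expectation p (\<lambda>x. measure_pmf.expectation (f x) g)"
proof -
  \<comment> \<open>\<open>integral_bind\<close> asks for a bound on the whole type, while
    \<open>g\<close> is bounded on the support only; \<open>h\<close> cuts \<open>g\<close> off
    outside the support, which no expectation notices.\<close>
  define h where "h y = (if y \<in> set_pmf (p \<bind> f) then g y else 0)" for y
  have h: "\<bar>h y\<bar> \<le> \<bar>C\<bar>" for y
    using bound[of y] by (cases "y \<in> set_pmf (p \<bind> f)") (simp_all add: h_def del: set_bind_pmf)
  have "measure_pmf.expectation (p \<bind> f) g = measure_pmf.expectation (p \<bind> f) h"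
    by (intro integral_cong_AE) (auto simp: AE_measure_pmf_iff h_def)
  also have "\<dots> = measure_pmf.expectation p (\<lambda>x. measure_pmf.expectation (f x) h)"
    unfolding measure_pmf_bind
    by (rule integral_bind[where K = "count_space UNIV" and B = "\<bar>C\<bar>" and B' = 1])
       (auto simp: h measure_pmf.emeasure_space_1 measure_subprob)
  also have "\<dots> = measure_pmf.expectation p (\<lambda>x. measure_pmf.expectation (f x) g)"
  proof (intro integral_cong_AE)
    show "AE x in measure_pmf p. measure_pmf.expectation (f x) h = measure_pmf.expectation (f x) g"
      unfolding AE_measure_pmf_iff
      by (intro ballI integral_cong_AE) (auto simp: AE_measure_pmf_iff h_def)
  qed auto
  finally show ?thesis .
qed

lemma integrable_pmf_bounded:
  fixes g :: "'a \<Rightarrow> real"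
  assumes "\<And>x. x \<in> set_pmf p \<Longrightarrow> \<bar>g x\<bar> \<le> C"
  shows "integrable (measure_pmf p) g"
  by (rule measure_pmf.integrable_const_bound[where B = C]) (auto simp: AE_measure_pmf_iff assms)

lemma expectation_mono_pmf:
  fixes f g :: "'a \<Rightarrow> real"
  assumes "\<And>x. x \<in> set_pmf p \<Longrightarrow> f x \<le> g x"
    and "\<And>x. x \<in> set_pmf p \<Longrightarrow> \<bar>f x\<bar> \<le> C" "\<And>x. x \<in> set_pmf p \<Longrightarrow> \<bar>g x\<bar> \<le> C'"
  shows "measure_pmf.expectation p f \<le> measure_pmf.expectation p g"
  by (intro integral_mono_AE integrable_pmf_bounded[OF assms(2)] integrable_pmf_bounded[OF assms(3)])
     (auto simp: AE_measure_pmf_iff assms(1))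

lemma expectation_cong_pmf:
  fixes f g :: "'a \<Rightarrow> real"
  assumes "\<And>x. x \<in> set_pmf p \<Longrightarrow> f x = g x"
  shows "measure_pmf.expectation p f = measure_pmf.expectation p g"
  by (intro integral_cong_AE) (auto simp: AE_measure_pmf_iff assms)

lemma expectation_bind_nonneg:
  fixes g :: "'b \<Rightarrow> real"
  assumes "\<And>y. y \<in> set_pmf (p \<bind> f) \<Longrightarrow> \<bar>g y\<bar> \<le> C"
    and "\<And>x. x \<in> set_pmf p \<Longrightarrow> 0 \<le> measure_pmf.expectation (f x) g"
  shows "0 \<le> measure_pmf.expectation (p \<bind> f) g"
  unfolding expectation_bind_pmf[of p f g C, OF assms(1), simplified]
  by (intro integral_nonneg_AE) (auto simp: AE_measure_pmf_iff assms(2))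

lemma prob_bind_pmf:
  "measure_pmf.prob (p \<bind> f) A = measure_pmf.expectation p (\<lambda>x. measure_pmf.prob (f x) A)"
  using expectation_bind_pmf[of p f "indicator A" 1] by (auto simp: indicator_def)

text \<open>Expectations conditioned on the same event share the denominator
  \<open>prob p A\<close>, so an inequality between them reduces to one between unconditional
  expectations weighted by \<open>indicator A\<close>.\<close>

lemma expectation_cond_pmf:
  fixes g :: "'a \<Rightarrow> real"
  assumes "set_pmf p \<inter> A \<noteq> {}"
  shows "measure_pmf.expectation (cond_pmf p A) g
    = measure_pmf.expectation p (\<lambda>x. indicator A x * g x) / measure_pmf.prob p A"
proof -
  have pos: "measure_pmf.prob p A > 0"
    using assms by (auto intro: measure_pmf_posI)
  have "indicator A x / emeasure (measure_pmf p) A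
      = ennreal (indicator A x / measure_pmf.prob p A)" for x
    using pos by (auto simp: measure_pmf.emeasure_eq_measure divide_ennreal indicator_def
        simp flip: ennreal_1)
  then have "measure_pmf.expectation (cond_pmf p A) g
    = measure_pmf.expectation p (\<lambda>x. (indicator A x / measure_pmf.prob p A) *\<^sub>R g x)"
    unfolding cond_pmf.rep_eq[OF assms] uniform_measure_def using pos
    by (subst integral_density[symmetric]) auto
  then show ?thesis
    by simp
qed

text \<open>For positive rates the convolution sum is the binomial expansion of
  \<open>(a + b) ^ n\<close> divided by \<open>fact n\<close>; at rate 0 \<open>poisson\<close> is
  the point mass at 0, which is neutral for the sum.\<close>

lemma poisson_add:
  assumes "0 \<le> a" "0 \<le> b"
  shows "do {x \<leftarrow> poisson a; y \<leftarrow> poisson b; return_pmf (x + y)} = poisson (a + b)"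
proof -
  consider "a = 0" | "b = 0" | "0 < a" "0 < b"
    using assms by fastforce
  then show ?thesis
  proof cases
    case 3
    have conv: "pmf (poisson_pmf b \<bind> (\<lambda>y. return_pmf (x + y))) n
      = (if x \<le> n then pmf (poisson_pmf b) (n - x) else 0)" for x n :: nat
    proof -
      have "poisson_pmf b \<bind> (\<lambda>y. return_pmf (x + y)) = map_pmf ((+) x) (poisson_pmf b)"
        by (simp add: map_pmf_def)
      moreover have "n = x + (n - x)" if "x \<le> n"
        using that by simp
      ultimately show ?thesis
        by (metis (no_types, lifting) imageE inj_on_add le_add1 pmf_map_inj' pmf_map_outside)
    qed
    have ex: "exp (- (a + b)) = exp (- a) * exp (- b)"
      by (simp add: mult_exp_exp)
    show ?thesis
    proof (rule pmf_eqI)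
      fix n :: nat
      have "pmf (do {x \<leftarrow> poisson_pmf a; y \<leftarrow> poisson_pmf b; return_pmf (x + y)}) n
        = measure_pmf.expectation (poisson_pmf a)
            (\<lambda>x. if x \<le> n then pmf (poisson_pmf b) (n - x) else 0)"
        by (simp only: pmf_bind[of "poisson_pmf a"] conv)
      also have "\<dots> = (\<Sum>x\<le>n. (if x \<le> n then pmf (poisson_pmf b) (n - x) else 0) * pmf (poisson_pmf a) x)"
        by (rule integral_measure_pmf_real) (auto split: if_splits)
      also have "\<dots> = (\<Sum>x\<le>n. exp (- (a + b)) / fact n * (real (n choose x) * a ^ x * b ^ (n - x)))"
        unfolding ex using 3 by (intro sum.cong refl) (simp add: binomial_fact field_simps)
      also have "\<dots> = exp (- (a + b)) / fact n * (a + b) ^ n"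
        by (simp add: binomial_ring sum_distrib_left)
      also have "\<dots> = pmf (poisson_pmf (a + b)) n"
        using 3 by simp
      finally show "pmf (do {x \<leftarrow> poisson a; y \<leftarrow> poisson b; return_pmf (x + y)}) n
          = pmf (poisson (a + b)) n"
        using 3 by (simp add: poisson_def)
    qed
  qed (simp_all add: poisson_def bind_return_pmf bind_return_pmf')
qed

section \<open>Uniformly random arrival orders\<close>

lemma set_pmf_random_order: "finite V \<Longrightarrow> set_pmf (random_order V) = permutations_of_set V"
  by (simp add: random_order_def)

lemma random_order_empty: "random_order {} = return_pmf []"
  by (simp add: random_order_def pmf_of_set_singleton)

lemma random_order_rec:
  assumes "finite V" "V \<noteq> {}"
  shows "random_order V = do {x \<leftarrow> pmf_of_set V; xs \<leftarrow> random_order (V - {x}); return_pmf (x # xs)}"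
  unfolding random_order_def by (rule random_permutation_of_set[OF assms])

text \<open>Given its first \<open>k\<close> entries, a uniform permutation has a uniformly ordered
  rest, so redrawing the rest leaves the law unchanged. The induction peels off the first arrival.
  This separates the suffix from everything that depends on the prefix.\<close>

lemma random_order_resample_suffix:
  assumes "finite V"
  shows "random_order V
    = do {vs \<leftarrow> random_order V; ws \<leftarrow> random_order (set (drop k vs)); return_pmf (take k vs @ ws)}"
  using assms
proof (induction k arbitrary: V)
  case 0
  have "random_order V \<bind> (\<lambda>vs. random_order (set vs)) = random_order V \<bind> (\<lambda>_. random_order V)"
    using 0 by (intro bind_pmf_cong refl) (simp add: set_pmf_random_order permutations_of_set_def)
  then show ?case
    by (simp add: bind_return_pmf')
next
  case (Suc k)
  show ?case
  proof (cases "V = {}")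
    case True
    then show ?thesis
      by (simp add: random_order_empty bind_return_pmf)
  next
    case False
    have "random_order V
      = do {x \<leftarrow> pmf_of_set V; xs \<leftarrow> random_order (V - {x}); return_pmf (x # xs)}"
      using Suc.prems False by (rule random_order_rec)
    also have "\<dots> = do {x \<leftarrow> pmf_of_set V; xs \<leftarrow> random_order (V - {x});
        ws \<leftarrow> random_order (set (drop k xs)); return_pmf (x # take k xs @ ws)}"
      by (subst Suc.IH) (use Suc.prems in \<open>simp_all add: bind_assoc_pmf bind_return_pmf\<close>)
    also have "\<dots> = do {vs \<leftarrow> random_order V; ws \<leftarrow> random_order (set (drop (Suc k) vs));
        return_pmf (take (Suc k) vs @ ws)}"
      by (subst random_order_rec[OF Suc.prems False])
         (simp add: bind_assoc_pmf bind_return_pmf)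
    finally show ?thesis .
  qed
qed

text \<open>Condition on the first arrival: if it is \<open>v\<close>, then \<open>v\<close> is not
  late; otherwise \<open>v\<close> has to avoid the next \<open>k\<close> places among
  \<open>card V - 1\<close> vertices. With \<open>N = card V\<close> the average is
  \<open>(N - 1) / N * (1 - k / (N - 1)) = 1 - (k + 1) / N\<close>.\<close>

lemma prob_mem_drop_random_order:
  assumes "finite V" "v \<in> V" "k \<le> card V"
  shows "measure_pmf.prob (random_order V) {vs. v \<in> set (drop k vs)} = 1 - real k / real (card V)"
  using assms
proof (induction k arbitrary: V)
  case 0
  have "measure_pmf.prob (random_order V) {vs. v \<in> set vs} = 1"
    using 0 by (subst measure_pmf.prob_eq_1)
      (auto simp: AE_measure_pmf_iff set_pmf_random_order permutations_of_set_def)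
  then show ?case
    by simp
next
  case (Suc k)
  have "V \<noteq> {}"
    using Suc.prems by auto
  have rec: "measure_pmf.prob (random_order V) {vs. v \<in> set (drop (Suc k) vs)}
    = measure_pmf.expectation (pmf_of_set V)
        (\<lambda>x. measure_pmf.prob (random_order (V - {x})) {vs. v \<in> set (drop k vs)})"
    by (subst random_order_rec[OF \<open>finite V\<close> \<open>V \<noteq> {}\<close>])
       (simp add: prob_bind_pmf[of "pmf_of_set V"] vimage_def flip: map_pmf_def)
  have step: "measure_pmf.prob (random_order (V - {x})) {vs. v \<in> set (drop k vs)}
      = (if x = v then 0 else 1 - real k / (real (card V) - 1))" if "x \<in> V" for x
  proof (cases "x = v")
    case True
    then have "measure_pmf.prob (random_order (V - {x})) {vs. v \<in> set (drop k vs)} = 0"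
      using Suc.prems
      by (subst measure_pmf_zero_iff)
         (auto simp: set_pmf_random_order permutations_of_set_def dest!: in_set_dropD)
    then show ?thesis using True by simp
  next
    case False
    then show ?thesis
      using that Suc.prems Suc.IH[of "V - {x}"] by (simp add: of_nat_diff)
  qed
  have "card V \<noteq> 0"
    using Suc.prems by auto
  then have "measure_pmf.prob (random_order V) {vs. v \<in> set (drop (Suc k) vs)}
    = (\<Sum>x\<in>V. if x = v then 0 else 1 - real k / (real (card V) - 1)) / real (card V)"
    unfolding rec by (subst integral_pmf_of_set) (use Suc.prems \<open>V \<noteq> {}\<close> step in auto)
  also have "(\<Sum>x\<in>V. if x = v then 0 else 1 - real k / (real (card V) - 1))
      = (\<Sum>x\<in>V - {v}. 1 - real k / (real (card V) - 1))"
    using Suc.prems by (subst sum.remove[of V v]) (auto intro: sum.cong)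
  also have "\<dots> = (real (card V) - 1) * (1 - real k / (real (card V) - 1))"
    using Suc.prems by (auto simp: of_nat_diff card_gt_0_iff Suc_le_eq)
  also have "\<dots> / real (card V) = 1 - real (Suc k) / real (card V)"
  \<comment> \<open>For a single vertex \<open>k = 0\<close>, the inner quotient is a division by
    zero, and both sides are 0.\<close>
  proof (cases "card V = 1")
    case True
    then show ?thesis using Suc.prems by simp
  next
    case False
    then have "real (card V) - 1 \<noteq> 0" by (simp add: of_nat_eq_iff[symmetric] del: of_nat_eq_iff)
    then show ?thesis using \<open>card V \<noteq> 0\<close> by (simp add: field_simps)
  qed
  finally show ?case .
qed

section \<open>IID draws from a random order\<close>

text \<open>An old element has weight \<open>card A / card V * (1 / card A)\<close> and a new one
  \<open>(1 - card A / card V) / (card V - card A)\<close>; both equal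
  \<open>1 / card V\<close>.\<close>

lemma bernoulli_mix_pmf_of_set:
  assumes "finite V" "A \<subset> V"
  shows "bernoulli_pmf (real (card A) / real (card V)) \<bind>
      (\<lambda>b. if b then pmf_of_set A else pmf_of_set (V - A)) = pmf_of_set V"
proof (rule pmf_eqI)
  fix x
  have fin: "finite A" and lt: "card A < card V" and ne: "V - A \<noteq> {}" "V \<noteq> {}"
    using assms by (auto intro: finite_subset psubset_card_mono)
  have "pmf (bernoulli_pmf (real (card A) / real (card V)) \<bind>
      (\<lambda>b. if b then pmf_of_set A else pmf_of_set (V - A))) x
    = real (card A) / real (card V) * pmf (pmf_of_set A) x
      + (1 - real (card A) / real (card V)) * pmf (pmf_of_set (V - A)) x"
    using lt by (simp add: pmf_bind algebra_simps)
  \<comment> \<open>For empty \<open>A\<close> the coefficient 0 hides the unspecified value of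
    \<open>pmf_of_set {}\<close>.\<close>
  also have "real (card A) / real (card V) * pmf (pmf_of_set A) x = indicator A x / real (card V)"
    using fin by (cases "A = {}") auto
  also have "(1 - real (card A) / real (card V)) * pmf (pmf_of_set (V - A)) x
      = indicator (V - A) x / real (card V)"
    using assms fin ne lt by (simp add: card_Diff_subset of_nat_diff field_simps psubset_imp_subset)
  also have "indicator A x / real (card V) + indicator (V - A) x / real (card V) = pmf (pmf_of_set V) x"
    using assms ne by (auto simp: indicator_def)
  finally show "pmf (bernoulli_pmf (real (card A) / real (card V)) \<bind>
      (\<lambda>b. if b then pmf_of_set A else pmf_of_set (V - A))) x = pmf (pmf_of_set V) x" .
qed

lemma map_pmf_nth_uniform:
  assumes "distinct us" "us \<noteq> []"
  shows "map_pmf ((!) us) (pmf_of_set {..<length us}) = pmf_of_set (set us)"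
proof -
  have "inj_on ((!) us) {..<length us}" "(!) us ` {..<length us} = set us"
    using assms by (auto simp: inj_on_def nth_eq_iff_index_eq set_conv_nth)
  then show ?thesis
    using assms by (subst map_pmf_of_set_inj) (auto simp: lessThan_empty_iff)
qed

text \<open>The induction needs an arbitrary list \<open>us\<close> of arrivals already used, with
  the others still in random order. Whatever \<open>us\<close> is, the next draw is uniform on
  \<open>V\<close>, hence independent of the earlier ones. The bound on \<open>length us + m\<close>
  keeps a fresh arrival available for every draw.\<close>

lemma iid_samples_random_order_aux:
  assumes "finite V" "distinct us" "set us \<subseteq> V" "length us + m \<le> card V"
  shows "random_order (V - set us) \<bind> (\<lambda>vs. iid_samples (card V) (us @ vs) m (length us))
    = replicate_pmf m (pmf_of_set V)"
  using assms(2-4)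
proof (induction m arbitrary: us)
  case (Suc m)
  define W where "W = V - set us"
  define b where "b = bernoulli_pmf (real (length us) / real (card V))"
  define rest where "rest y = map_pmf ((#) y) (replicate_pmf m (pmf_of_set V))" for y
  have card_us: "card (set us) = length us"
    using Suc.prems by (simp add: distinct_card)
  then have psub: "set us \<subset> V"
    using Suc.prems assms(1) by auto
  then have W: "finite W" "W \<noteq> {}"
    using assms(1) by (auto simp: W_def)
  have Wx: "V - insert x (set us) = W - {x}" for x
    by (auto simp: W_def)
  \<comment> \<open>A reused sample is read off \<open>us\<close> alone, so its index can be drawn
    before the order of the remaining vertices.\<close>
  have old: "random_order W \<bind> (\<lambda>vs. pmf_of_set {..<length us} \<bind> (\<lambda>j.
        map_pmf ((#) ((us @ vs) ! j)) (iid_samples (card V) (us @ vs) m (length us))))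
      = pmf_of_set (set us) \<bind> rest" if "us \<noteq> []"
  proof -
    have "random_order W \<bind> (\<lambda>vs. pmf_of_set {..<length us} \<bind> (\<lambda>j.
        map_pmf ((#) ((us @ vs) ! j)) (iid_samples (card V) (us @ vs) m (length us))))
      = pmf_of_set {..<length us} \<bind> (\<lambda>j. random_order W \<bind> (\<lambda>vs.
        map_pmf ((#) ((us @ vs) ! j)) (iid_samples (card V) (us @ vs) m (length us))))"
      by (rule bind_commute_pmf)
    also have "\<dots> = pmf_of_set {..<length us} \<bind> (\<lambda>j. random_order W \<bind> (\<lambda>vs.
        map_pmf ((#) (us ! j)) (iid_samples (card V) (us @ vs) m (length us))))"
      using that by (intro bind_pmf_cong refl) (simp add: nth_append lessThan_empty_iff)
    also have "\<dots> = pmf_of_set {..<length us} \<bind> (\<lambda>j. rest (us ! j))"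
      unfolding rest_def map_bind_pmf[symmetric] W_def
      using Suc.prems by (subst Suc.IH) auto
    also have "\<dots> = pmf_of_set (set us) \<bind> rest"
      using Suc.prems that by (subst map_pmf_nth_uniform[symmetric]) (auto simp: bind_map_pmf)
    finally show ?thesis .
  qed
  \<comment> \<open>A fresh sample is the head \<open>x\<close> of the remaining order; moving it to
    the end of \<open>us\<close> gives the induction hypothesis for \<open>us @ [x]\<close>.\<close>
  have new: "random_order W \<bind> (\<lambda>vs.
        map_pmf ((#) ((us @ vs) ! length us)) (iid_samples (card V) (us @ vs) m (Suc (length us))))
      = pmf_of_set W \<bind> rest"
  proof -
    have "random_order W \<bind> (\<lambda>vs.
        map_pmf ((#) ((us @ vs) ! length us)) (iid_samples (card V) (us @ vs) m (Suc (length us))))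
      = pmf_of_set W \<bind> (\<lambda>x. map_pmf ((#) x) (random_order (V - set (us @ [x])) \<bind> (\<lambda>vs.
         iid_samples (card V) ((us @ [x]) @ vs) m (length (us @ [x])))))"
      by (subst random_order_rec[OF W])
         (simp add: bind_assoc_pmf bind_return_pmf map_bind_pmf Wx)
    also have "\<dots> = pmf_of_set W \<bind> rest"
      using Suc.prems W by (intro bind_pmf_cong refl, subst Suc.IH) (auto simp: rest_def W_def)
    finally show ?thesis .
  qed
  have "random_order W \<bind> (\<lambda>vs. iid_samples (card V) (us @ vs) (Suc m) (length us))
    = random_order W \<bind> (\<lambda>vs. b \<bind> (\<lambda>b. if b
        then pmf_of_set {..<length us} \<bind> (\<lambda>j.
          map_pmf ((#) ((us @ vs) ! j)) (iid_samples (card V) (us @ vs) m (length us)))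
        else map_pmf ((#) ((us @ vs) ! length us)) (iid_samples (card V) (us @ vs) m (Suc (length us)))))"
    by (simp add: b_def map_pmf_def cong: if_cong)
  also have "\<dots> = b \<bind> (\<lambda>b. random_order W \<bind> (\<lambda>vs. if b
        then pmf_of_set {..<length us} \<bind> (\<lambda>j.
          map_pmf ((#) ((us @ vs) ! j)) (iid_samples (card V) (us @ vs) m (length us)))
        else map_pmf ((#) ((us @ vs) ! length us)) (iid_samples (card V) (us @ vs) m (Suc (length us)))))"
    by (rule bind_commute_pmf)
  also have "\<dots> = b \<bind> (\<lambda>b. (if b then pmf_of_set (set us) else pmf_of_set W) \<bind> rest)"
  proof (intro bind_pmf_cong refl)
    fix x assume "x \<in> set_pmf b"
    \<comment> \<open>With nothing used yet the coin has bias 0, so the choice from an empty index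
      set never occurs.\<close>
    then have "us \<noteq> []" if x
      using that by (auto simp: b_def set_pmf_iff)
    then show "random_order W \<bind> (\<lambda>vs. if x
        then pmf_of_set {..<length us} \<bind> (\<lambda>j.
          map_pmf ((#) ((us @ vs) ! j)) (iid_samples (card V) (us @ vs) m (length us)))
        else map_pmf ((#) ((us @ vs) ! length us)) (iid_samples (card V) (us @ vs) m (Suc (length us))))
      = (if x then pmf_of_set (set us) else pmf_of_set W) \<bind> rest"
      using old new by (cases x) simp_all
  qed
  also have "\<dots> = pmf_of_set V \<bind> rest"
    unfolding bind_assoc_pmf[symmetric] b_def W_def card_us[symmetric]
    by (subst bernoulli_mix_pmf_of_set[OF assms(1) psub]) simp
  finally show ?case
    by (simp add: W_def rest_def[abs_def] map_pmf_def)
qed simp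

lemma iid_samples_random_order:
  assumes "finite V" "m \<le> card V"
  shows "random_order V \<bind> (\<lambda>vs. iid_samples (card V) vs m 0) = replicate_pmf m (pmf_of_set V)"
  using iid_samples_random_order_aux[of V "[]" m] assms by simp

text \<open>With \<open>i\<close> entries used, \<open>m\<close> draws read no index from
  \<open>i + m\<close> on. Thus the stored prefix can be exchanged for the whole arrival
  order.\<close>

lemma iid_samples_cong:
  assumes "\<And>j. j < i + m \<Longrightarrow> A ! j = A' ! j"
  shows "iid_samples n A m i = iid_samples n A' m i"
  using assms
proof (induction m arbitrary: i)
  case (Suc m)
  have "pmf_of_set {..<i} \<bind> (\<lambda>j. iid_samples n A m i \<bind> (\<lambda>xs. return_pmf (A ! j # xs)))
    = pmf_of_set {..<i} \<bind> (\<lambda>j. iid_samples n A' m i \<bind> (\<lambda>xs. return_pmf (A' ! j # xs)))" if "0 < i"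
    using that Suc by (intro bind_pmf_cong) (auto simp: lessThan_empty_iff)
  moreover have "iid_samples n A m (Suc i) = iid_samples n A' m (Suc i)"
    using Suc.prems by (intro Suc.IH) simp
  ultimately show ?case
    using Suc.prems[of i] unfolding iid_samples.simps
    by (intro bind_pmf_cong refl) (simp split: if_split, force simp: set_pmf_iff)
qed simp

lemma iid_samples_map:
  assumes "i + m \<le> length A"
  shows "iid_samples n (map f A) m i = map_pmf (map f) (iid_samples n A m i)"
  using assms
proof (induction m arbitrary: i)
  case (Suc m)
  have "pmf_of_set {..<i} \<bind> (\<lambda>j. iid_samples n (map f A) m i \<bind> (\<lambda>xs. return_pmf (map f A ! j # xs)))
    = map_pmf (map f) (pmf_of_set {..<i} \<bind> (\<lambda>j. iid_samples n A m i \<bind> (\<lambda>xs. return_pmf (A ! j # xs))))"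
    if "0 < i"
    using that Suc unfolding map_bind_pmf
    by (intro bind_pmf_cong) (auto simp: lessThan_empty_iff bind_map_pmf map_bind_pmf)
  moreover have "iid_samples n (map f A) m (Suc i) \<bind> (\<lambda>xs. return_pmf (map f A ! i # xs))
    = map_pmf (map f) (iid_samples n A m (Suc i) \<bind> (\<lambda>xs. return_pmf (A ! i # xs)))"
    using Suc by (simp add: bind_map_pmf map_bind_pmf)
  ultimately show ?case
    unfolding iid_samples.simps map_bind_pmf[of _ "bernoulli_pmf _"]
    by (intro bind_pmf_cong refl) (simp split: if_split, force simp: set_pmf_iff)
qed simp

lemma map_replicate_pmf: "map_pmf (map f) (replicate_pmf m p) = replicate_pmf m (map_pmf f p)"
proof (induction m)
  case (Suc m)
  have "map_pmf (map f) (map_pmf ((#) x) (replicate_pmf m p))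
    = map_pmf ((#) (f x)) (replicate_pmf m (map_pmf f p))" for x
    by (simp add: pmf.map_comp o_def flip: Suc)
  then show ?case
    by (simp add: map_bind_pmf[of _ p] bind_map_pmf flip: map_pmf_def)
qed simp

section \<open>Matchings and Mimic\<close>

lemma finite_card_matchings:
  assumes "finite E"
  shows "finite (card ` {M. is_matching E M})"
proof -
  have "{M. is_matching E M} \<subseteq> Pow E"
    by (auto simp: is_matching_def)
  then show ?thesis
    using assms by (meson finite_Pow_iff finite_imageI finite_subset)
qed

lemma card_matching_le_max:
  assumes "finite E" "is_matching E M"
  shows "card M \<le> max_matching_size E"
  unfolding max_matching_size_def
  using assms by (intro Max_ge finite_card_matchings) auto

lemma max_matching_exists:
  assumes "finite E"
  obtains M where "is_matching E M" "card M = max_matching_size E"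
proof -
  have "is_matching E {}"
    by (simp add: is_matching_def)
  then have "max_matching_size E \<in> card ` {M. is_matching E M}"
    unfolding max_matching_size_def by (intro Max_in finite_card_matchings assms) auto
  then show ?thesis
    using that by auto
qed

lemma is_matching_finite: "finite E \<Longrightarrow> is_matching E M \<Longrightarrow> finite M"
  by (auto simp: is_matching_def intro: finite_subset)

lemma is_matching_subset: "is_matching E M \<Longrightarrow> M' \<subseteq> M \<Longrightarrow> M' \<subseteq> E' \<Longrightarrow> is_matching E' M'"
  by (auto simp: is_matching_def intro: inj_on_subset)

lemma is_matching_mono: "is_matching E' M \<Longrightarrow> E' \<subseteq> E \<Longrightarrow> is_matching E M"
  by (auto simp: is_matching_def)

lemma is_matching_Un:
  assumes "is_matching E M" "is_matching E M'" "fst ` M \<inter> fst ` M' = {}" "snd ` M \<inter> snd ` M' = {}"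
  shows "is_matching E (M \<union> M')"
  using assms unfolding is_matching_def by (auto simp: inj_on_Un)

lemma card_matching_le_card_snd:
  assumes "is_matching E M" "snd ` M \<subseteq> W" "finite W"
  shows "card M \<le> card W"
proof -
  have "card M = card (snd ` M)"
    using assms by (simp add: is_matching_def card_image)
  then show ?thesis
    using card_mono[OF assms(3,2)] by simp
qed

lemma max_matching_size_mono:
  assumes "finite E" "E' \<subseteq> E"
  shows "max_matching_size E' \<le> max_matching_size E"
proof -
  obtain M where "is_matching E' M" "card M = max_matching_size E'"
    using max_matching_exists finite_subset[OF assms(2,1)] .
  then show ?thesis
    using card_matching_le_max[OF assms(1)] is_matching_mono assms(2) by metis
qed

lemma max_matching_size_le_card:
  assumes "finite V" "finite E" "snd ` E \<subseteq> V"
  shows "max_matching_size E \<le> card V"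
proof -
  obtain M where "is_matching E M" "card M = max_matching_size E"
    using max_matching_exists assms(2) .
  then show ?thesis
    using card_matching_le_card_snd[of E M V] assms by (auto simp: is_matching_def)
qed

text \<open>Each deleted offline vertex lies on at most one edge of a maximum matching. This bounds
  what the offline vertices taken in the prefix can cost the suffix.\<close>

lemma max_matching_size_remove_offline:
  assumes "finite E" "finite A"
  shows "max_matching_size E \<le> max_matching_size {e \<in> E. fst e \<notin> A} + card A"
proof -
  obtain M where M: "is_matching E M" "card M = max_matching_size E"
    using max_matching_exists assms(1) .
  have fin: "finite M"
    using M assms(1) is_matching_finite by blast
  have "card M = card ({e \<in> M. fst e \<notin> A} \<union> {e \<in> M. fst e \<in> A})"
    by (intro arg_cong[where f = card]) auto
  then have "card M \<le> card {e \<in> M. fst e \<notin> A} + card {e \<in> M. fst e \<in> A}"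
    by (simp only: card_Un_le)
  moreover have "card {e \<in> M. fst e \<notin> A} \<le> max_matching_size {e \<in> E. fst e \<notin> A}"
    using M assms(1)
    by (intro card_matching_le_max is_matching_subset[OF M(1)]) (auto simp: is_matching_def)
  moreover have "card {e \<in> M. fst e \<in> A} \<le> card A"
    using M by (intro card_inj_on_le[of fst] assms(2)) (auto simp: is_matching_def inj_on_def)
  ultimately show ?thesis
    using M(2) by simp
qed

section \<open>Runs of an admissible online algorithm\<close>

text \<open>The algorithm sees the graph only through the neighbourhoods within \<open>U\<close>. So
  a run on the unmatched offline vertices is also a run on the graph with the edges at matched ones
  deleted.\<close>

lemma run_from_cong:
  assumes "\<And>v. v \<in> set vs \<Longrightarrow> nbhd E v \<inter> U = nbhd E' v \<inter> U"
  shows "run_from B U N E vs h = run_from B U N E' vs h"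
  using assms by (induction vs arbitrary: h) (simp_all add: Let_def)

text \<open>The last conjunct strengthens the induction: an offline vertex recorded in the history
  is never taken again, which keeps \<open>fst\<close> injective when an edge is added.\<close>

lemma run_from_matching:
  assumes "admissible B" "distinct vs" "M \<in> set_pmf (run_from B U N E vs h)"
  shows "is_matching E M \<and> snd ` M \<subseteq> set vs \<and> fst ` M \<subseteq> U \<and> (\<forall>u\<in>fst ` M. \<forall>t. (t, Some u) \<notin> set h)"
  using assms(2,3)
proof (induction vs arbitrary: h M)
  case Nil
  then show ?case
    by (simp add: is_matching_def)
next
  case (Cons v vs)
  let ?t = "nbhd E v \<inter> U"
  obtain x M' where x: "x \<in> set_pmf (B U N h ?t)"
    and M': "M' \<in> set_pmf (run_from B U N E vs (h @ [(?t, x)]))"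
    and M: "M = (case x of None \<Rightarrow> M' | Some u \<Rightarrow> insert (u, v) M')"
    using Cons.prems(2) by (auto simp: Let_def)
  have IH: "is_matching E M'" "snd ` M' \<subseteq> set vs" "fst ` M' \<subseteq> U"
    "\<forall>u\<in>fst ` M'. \<forall>t. (t, Some u) \<notin> set (h @ [(?t, x)])"
    using Cons.IH[OF _ M'] Cons.prems(1) by auto
  show ?case
  proof (cases x)
    case None
    then show ?thesis
      using IH M by auto
  next
    case (Some u)
    have "Some u \<in> insert None (Some ` {u \<in> ?t. \<forall>t'. (t', Some u) \<notin> set h})"
      using x Some assms(1) unfolding admissible_def by blast
    then have u: "u \<in> ?t" "\<forall>t'. (t', Some u) \<notin> set h"
      by auto
    have "(u, v) \<in> E" "u \<in> U"
      using u by (auto simp: nbhd_def)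
    moreover have "u \<notin> fst ` M'" "v \<notin> snd ` M'"
      using IH Some Cons.prems(1) by auto
    ultimately show ?thesis
      using IH M Some u unfolding is_matching_def by auto
  qed
qed

lemma run_alg_matching:
  assumes "admissible B" "distinct vs" "M \<in> set_pmf (run_alg B U E vs)"
  shows "is_matching E M" "snd ` M \<subseteq> set vs" "fst ` M \<subseteq> U"
  using run_from_matching[OF assms(1,2), of M] assms(3) by (auto simp: run_alg_def)

section \<open>Mimic and the loss measured by the L1 distance\<close>

locale mimic_setting =
  fixes E :: "('u \<times> 'v) set" and c :: "'u set \<Rightarrow> nat"
    and Mhat :: "('u \<times> ('u set \<times> nat)) set"
    and pick :: "'u set list \<Rightarrow> ('u set \<times> nat) set \<Rightarrow> 'u set \<times> nat"
  assumes Mhat: "is_matching (advice_edges c) Mhat"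
    and pick: "\<And>h C. C \<noteq> {} \<Longrightarrow> pick h C \<in> C"
begin

text \<open>Each arrival of type \<open>t\<close> consumes one advice vertex of that type until all
  \<open>c t\<close> are gone, whence the minimum. The last conjunct ties the occupied offline
  vertices to the consumed advice vertices; it shows that a new edge cannot collide with an old one,
  and later it lets edges be counted in \<open>Mhat\<close>.\<close>

lemma mimic_invariant:
  assumes "distinct vs" "fold (mimic_step pick c Mhat E) vs ([], {}, {}) = (h, used, M)"
  shows "used \<subseteq> advice_vertices c
    \<and> (\<forall>t. card {w \<in> used. fst w = t} = min (card {v \<in> set vs. nbhd E v = t}) (c t))
    \<and> is_matching E M \<and> snd ` M \<subseteq> set vs \<and> fst ` M = fst ` {e \<in> Mhat. snd e \<in> used}"
  using assms
proof (induction vs arbitrary: h used M rule: rev_induct)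
  case Nil
  then show ?case
    by (simp add: is_matching_def)
next
  case (snoc v vs)
  obtain h' used' M' where fold: "fold (mimic_step pick c Mhat E) vs ([], {}, {}) = (h', used', M')"
    by (metis prod_cases3)
  define t where "t = nbhd E v"
  define C where "C = {w \<in> advice_vertices c. fst w = t \<and> w \<notin> used'}"
  define w where "w = pick h' C"
  have IH: "used' \<subseteq> advice_vertices c"
    "\<And>t. card {w \<in> used'. fst w = t} = min (card {v \<in> set vs. nbhd E v = t}) (c t)"
    "is_matching E M'" "snd ` M' \<subseteq> set vs" "fst ` M' = fst ` {e \<in> Mhat. snd e \<in> used'}"
    using snoc.IH[OF _ fold] snoc.prems(1) by auto
  have "(h, used, M) = mimic_step pick c Mhat E v (h', used', M')"
    using snoc.prems(2) fold by simp
  then have step: "(h, used, M) = (if C = {} then (h' @ [t], used', M')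
        else (h' @ [t], insert w used', M' \<union> {(u, v) |u. (u, w) \<in> Mhat}))"
    by (simp only: mimic_step_def Let_def prod.case C_def t_def w_def)
  have "v \<notin> set vs"
    using snoc.prems(1) by simp
  have cnt: "card {v' \<in> set (vs @ [v]). nbhd E v' = t'}
      = (if t' = t then Suc (card {v \<in> set vs. nbhd E v = t'}) else card {v \<in> set vs. nbhd E v = t'})"
    for t'
  proof -
    have "{v' \<in> set (vs @ [v]). nbhd E v' = t'}
      = (if t' = t then insert v {v \<in> set vs. nbhd E v = t'} else {v \<in> set vs. nbhd E v = t'})"
      by (auto simp: t_def)
    then show ?thesis
      using \<open>v \<notin> set vs\<close> by simp
  qed
  have adv_t: "{w \<in> advice_vertices c. fst w = t} = {t} \<times> {..<c t}"
    by (auto simp: advice_vertices_def)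
  have sub: "{w \<in> used'. fst w = t} \<subseteq> {t} \<times> {..<c t}"
    using IH(1) adv_t by auto
  show ?case
  proof (cases "C = {}")
    case True
    \<comment> \<open>All advice vertices of type \<open>t\<close> are consumed, so the minimum is
      already \<open>c t\<close> and one more arrival does not change it.\<close>
    then have "{w \<in> used'. fst w = t} = {t} \<times> {..<c t}"
      using IH(1) adv_t unfolding C_def by blast
    then have "card {w \<in> used'. fst w = t} = c t"
      by simp
    then have "c t \<le> card {v \<in> set vs. nbhd E v = t}"
      using IH(2)[of t] by simp
    then have "card {w \<in> used'. fst w = t'}
        = min (card {v' \<in> set (vs @ [v]). nbhd E v' = t'}) (c t')" for t'
      unfolding IH(2) cnt by auto
    then show ?thesis
      using IH step True by auto
  next
    case False
    then have "w \<in> C"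
      unfolding w_def by (rule pick)
    then have w: "w \<in> advice_vertices c" "fst w = t" "w \<notin> used'"
      by (auto simp: C_def)
    have st: "used = insert w used'" "M = M' \<union> {(u, v) |u. (u, w) \<in> Mhat}"
      using step False by auto
    \<comment> \<open>Some advice vertex of type \<open>t\<close> is left, so the minimum was the
      number of arrivals, and it grows by one.\<close>
    have "{w \<in> used'. fst w = t} \<subset> {t} \<times> {..<c t}"
      using sub w adv_t by blast
    then have less: "card {w \<in> used'. fst w = t} < c t"
      using psubset_card_mono[of "{t} \<times> {..<c t}"] by simp
    have fin: "finite {w \<in> used'. fst w = t}"
      using sub by (rule finite_subset) simp
    have used_card: "card {x \<in> used. fst x = t'}
        = min (card {v' \<in> set (vs @ [v]). nbhd E v' = t'}) (c t')" for t'
    proof (cases "t' = t")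
      case True
      have "{x \<in> used. fst x = t} = insert w {x \<in> used'. fst x = t}"
        using w(2) st(1) by auto
      then have "card {x \<in> used. fst x = t} = Suc (card {x \<in> used'. fst x = t})"
        using fin w(3) by simp
      then show ?thesis
        using True less IH(2)[of t] unfolding cnt by (simp split: if_splits)
    next
      case False
      then have "{x \<in> used. fst x = t'} = {x \<in> used'. fst x = t'}"
        using w(2) st(1) by auto
      then show ?thesis
        using False IH(2)[of t'] unfolding cnt by simp
    qed
    \<comment> \<open>The set has at most one element, as \<open>Mhat\<close> covers
      \<open>w\<close> at most once; it consists of edges of \<open>E\<close> because the type of
      \<open>w\<close> is the neighbourhood of \<open>v\<close>.\<close>
    have new: "is_matching E {(u, v) |u. (u, w) \<in> Mhat}"
      using Mhat w(2) unfolding is_matching_def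
      by (fastforce simp: inj_on_def advice_edges_def t_def nbhd_def)
    have fst_new: "fst ` {(u, v) |u. (u, w) \<in> Mhat} = fst ` {e \<in> Mhat. snd e = w}"
      by force
    \<comment> \<open>A common offline vertex would lie on two edges of \<open>Mhat\<close>, one at
      \<open>w\<close> and one at a vertex consumed earlier.\<close>
    have "fst ` {e \<in> Mhat. snd e \<in> used'} \<inter> fst ` {e \<in> Mhat. snd e = w} = {}"
    proof (rule ccontr)
      assume "fst ` {e \<in> Mhat. snd e \<in> used'} \<inter> fst ` {e \<in> Mhat. snd e = w} \<noteq> {}"
      then obtain e e' where "e \<in> Mhat" "e' \<in> Mhat" "fst e = fst e'" "snd e \<in> used'" "snd e' = w"
        by blast
      then show False
        using Mhat w(3) unfolding is_matching_def by (metis inj_onD)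
    qed
    then have "is_matching E M"
      unfolding st(2) using \<open>v \<notin> set vs\<close> IH(4)
      by (intro is_matching_Un IH(3) new) (auto simp: fst_new IH(5))
    moreover have "{e \<in> Mhat. snd e \<in> used} = {e \<in> Mhat. snd e \<in> used'} \<union> {e \<in> Mhat. snd e = w}"
      unfolding st(1) by auto
    then have "fst ` M = fst ` {e \<in> Mhat. snd e \<in> used}"
      unfolding st(2) image_Un IH(5) fst_new by (simp add: image_Un)
    moreover have "snd ` M \<subseteq> set (vs @ [v])"
      unfolding st(2) using IH(4) by auto
    moreover have "used \<subseteq> advice_vertices c"
      using IH(1) w(1) st(1) by simp
    ultimately show ?thesis
      using used_card by blast
  qed
qed

lemma mimic_matching:
  assumes "distinct vs"
  shows "is_matching E (mimic pick c Mhat E vs)" "snd ` mimic pick c Mhat E vs \<subseteq> set vs"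
proof -
  obtain h used M where "fold (mimic_step pick c Mhat E) vs ([], {}, {}) = (h, used, M)"
    by (metis prod_cases3)
  from mimic_invariant[OF assms this] this
  show "is_matching E (mimic pick c Mhat E vs)" "snd ` mimic pick c Mhat E vs \<subseteq> set vs"
    by (auto simp: mimic_def)
qed

lemma card_mimic_ge:
  assumes "finite U" "\<And>t. \<not> t \<subseteq> U \<Longrightarrow> c t = 0" "(\<Sum>t\<in>Pow U. c t) = card V"
    and "finite V" "E \<subseteq> U \<times> V" "vs \<in> permutations_of_set V" "0 < card V"
    and L: "L = L1 (Pow U) (\<lambda>t. real (type_count E V t) / real (card V)) (\<lambda>t. real (c t) / real (card V))"
  shows "real (card (mimic pick c Mhat E vs)) \<ge> real (card Mhat) - real (card V) * L / 2"
proof -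
  obtain h used M where fold: "fold (mimic_step pick c Mhat E) vs ([], {}, {}) = (h, used, M)"
    by (metis prod_cases3)
  have vs: "distinct vs" "set vs = V"
    using assms(6) by (auto simp: permutations_of_set_def)
  have used: "used \<subseteq> advice_vertices c"
    "\<And>t. card {w \<in> used. fst w = t} = min (type_count E V t) (c t)"
    and M: "is_matching E M" "fst ` M = fst ` {e \<in> Mhat. snd e \<in> used}"
    using mimic_invariant[OF vs(1) fold] vs(2) by (auto simp: type_count_def)
  have adv: "advice_vertices c = (SIGMA t:Pow U. {..<c t})"
    using assms(2) by (force simp: advice_vertices_def)
  have fin_adv: "finite (advice_vertices c)" and card_adv: "card (advice_vertices c) = card V"
    unfolding adv using assms(1,3) by simp_all
  have fin_used: "finite used"
    using used(1) fin_adv finite_subset by blast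
  have "fst w \<subseteq> U" if "w \<in> used" for w
    using that used(1) unfolding adv by (cases w) auto
  then have "card used = card (\<Union>t\<in>Pow U. {w \<in> used. fst w = t})"
    by (intro arg_cong[where f = card]) auto
  also have "\<dots> = (\<Sum>t\<in>Pow U. card {w \<in> used. fst w = t})"
    using assms(1) fin_used by (intro card_UN_disjoint) auto
  finally have card_used: "card used = (\<Sum>t\<in>Pow U. min (type_count E V t) (c t))"
    using used(2) by simp
  have "card V = card (\<Union>t\<in>Pow U. {v \<in> V. nbhd E v = t})"
    using assms(5) by (intro arg_cong[where f = card]) (auto simp: nbhd_def)
  also have "\<dots> = (\<Sum>t\<in>Pow U. type_count E V t)"
    unfolding type_count_def using assms(1,4) by (intro card_UN_disjoint) auto
  finally have card_V: "card V = (\<Sum>t\<in>Pow U. type_count E V t)" .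
  have "real (card V) * L = (\<Sum>t\<in>Pow U. \<bar>real (type_count E V t) - real (c t)\<bar>)"
    unfolding L L1_def sum_distrib_left using assms(7)
    by (intro sum.cong refl) (simp add: diff_divide_distrib[symmetric])
  \<comment> \<open>The distance of two numbers is their sum minus twice their minimum, and both
    families of counts sum to \<open>card V\<close>.\<close>
  also have "\<dots> = (\<Sum>t\<in>Pow U. real (type_count E V t) + real (c t)
      - 2 * real (min (type_count E V t) (c t)))"
    by (intro sum.cong refl) auto
  also have "\<dots> = 2 * real (card V) - 2 * real (card used)"
    unfolding card_used sum_subtractf sum.distrib sum_distrib_left[symmetric] of_nat_sum[symmetric]
    using card_V assms(3) by linarith
  finally have nL: "real (card V) * L / 2 = real (card V) - real (card used)"
    by (simp add: field_simps)
  have fin_Mhat: "finite Mhat"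
    by (rule inj_on_finite[of snd _ "advice_vertices c"])
       (use Mhat fin_adv in \<open>auto simp: is_matching_def advice_edges_def\<close>)
  \<comment> \<open>Edges of \<open>Mhat\<close> at consumed advice vertices correspond to the edges
    of \<open>M\<close> through their offline ends; the others inject into the leftover advice
    vertices.\<close>
  have "card Mhat = card ({e \<in> Mhat. snd e \<in> used} \<union> {e \<in> Mhat. snd e \<notin> used})"
    by (rule arg_cong[where f = card]) auto
  also have "\<dots> = card {e \<in> Mhat. snd e \<in> used} + card {e \<in> Mhat. snd e \<notin> used}"
    using fin_Mhat by (intro card_Un_disjoint) auto
  also have "card {e \<in> Mhat. snd e \<in> used} = card (fst ` {e \<in> Mhat. snd e \<in> used})"
    using Mhat by (intro card_image[symmetric]) (auto simp: is_matching_def inj_on_def)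
  also have "\<dots> = card M"
    unfolding M(2)[symmetric] using M(1) by (intro card_image) (auto simp: is_matching_def)
  also have "card {e \<in> Mhat. snd e \<notin> used} \<le> card (advice_vertices c - used)"
    using Mhat fin_adv
    by (intro card_inj_on_le[of snd]) (auto simp: is_matching_def inj_on_def advice_edges_def)
  also have "card (advice_vertices c - used) = card V - card used"
    using used(1) fin_used card_adv by (simp add: card_Diff_subset)
  finally have "card Mhat \<le> card M + (card V - card used)"
    by simp
  moreover have "card used \<le> card V"
    using card_mono[OF fin_adv used(1)] card_adv by simp
  ultimately have "real (card Mhat) \<le> real (card M) + real (card V) - real (card used)"
    by linarith
  moreover have "mimic pick c Mhat E vs = M"
    using fold by (simp add: mimic_def)
  ultimately show ?thesis
    unfolding nL by simp
qed

end

text \<open>Outside the advice support \<open>c\<close> vanishes, so each such type contributes just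
  its frequency. Merging these types into \<open>None\<close> adds up the frequencies and preserves
  the distance.\<close>

lemma L1_test_domain:
  assumes "finite U" "\<And>t. \<not> t \<subseteq> U \<Longrightarrow> c t = 0" "finite V" "E \<subseteq> U \<times> V" "V \<noteq> {}"
  shows "L1 (test_domain c) (pmf (map_pmf (\<lambda>v. relabel c (nbhd E v)) (pmf_of_set V))) (test_dist c (card V))
    = L1 (Pow U) (\<lambda>t. real (type_count E V t) / real (card V)) (\<lambda>t. real (c t) / real (card V))"
proof -
  let ?p = "map_pmf (\<lambda>v. relabel c (nbhd E v)) (pmf_of_set V)"
  let ?T = "advice_support c"
  let ?d = "\<lambda>t. \<bar>real (type_count E V t) / real (card V) - real (c t) / real (card V)\<bar>"
  have sub: "?T \<subseteq> Pow U"
    using assms(2) by (force simp: advice_support_def)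
  have fin: "finite ?T"
    using sub assms(1) by (meson finite_Pow_iff finite_subset)
  have pmf: "pmf ?p x = real (card {v \<in> V. relabel c (nbhd E v) = x}) / real (card V)" for x
    using assms(3,5) by (simp add: pmf_map measure_pmf_of_set vimage_def Int_def)
  have Some: "pmf ?p (Some t) = real (type_count E V t) / real (card V)" if "t \<in> ?T" for t
    using that unfolding pmf type_count_def
    by (intro arg_cong2[where f = "(/)"] arg_cong[where f = real] arg_cong[where f = card] refl)
       (auto simp: relabel_def)
  have "card {v \<in> V. relabel c (nbhd E v) = None} = card (\<Union>t\<in>Pow U - ?T. {v \<in> V. nbhd E v = t})"
    using assms(4) by (intro arg_cong[where f = card]) (auto simp: relabel_def nbhd_def split: if_splits)
  also have "\<dots> = (\<Sum>t\<in>Pow U - ?T. type_count E V t)"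
    unfolding type_count_def using assms(1,3) by (intro card_UN_disjoint) auto
  finally have None: "pmf ?p None = (\<Sum>t\<in>Pow U - ?T. ?d t)"
    unfolding pmf by (simp add: advice_support_def sum_divide_distrib)
  have "L1 (test_domain c) (pmf ?p) (test_dist c (card V))
    = pmf ?p None + (\<Sum>t\<in>?T. \<bar>pmf ?p (Some t) - real (c t) / real (card V)\<bar>)"
    unfolding L1_def test_domain_def using fin
    by (subst sum.insert) (auto simp: test_dist_def sum.reindex)
  also have "\<dots> = (\<Sum>t\<in>Pow U - ?T. ?d t) + (\<Sum>t\<in>?T. ?d t)"
    unfolding None using Some by simp
  also have "\<dots> = (\<Sum>t\<in>Pow U. ?d t)"
    using sub assms(1) by (intro sum.subset_diff[symmetric]) auto
  finally show ?thesis
    by (simp add: L1_def)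
qed

section \<open>The test and the suffix\<close>

text \<open>Within the budget all draws come from the first \<open>k\<close> arrivals, where they
  agree with draws from the whole random order, and these are IID. The budget check is kept in
  place, so the result differs from \<open>estimate_iid\<close> in the \<open>Fail\<close> branch
  only.\<close>

lemma run_test_random_order:
  assumes "finite V" "k = test_length s r" "k \<le> card V"
  shows "random_order V \<bind> (\<lambda>vs. run_test (card V) s r est (map g (take k vs)))
    = do {
        s1 \<leftarrow> poisson (real s / 2);
        s2 \<leftarrow> poisson (real s / 2);
        if real (s1 + s2) > test_budget s r then return_pmf Fail
        else do {
          xs \<leftarrow> replicate_pmf s1 (map_pmf g (pmf_of_set V));
          ys \<leftarrow> replicate_pmf s2 (map_pmf g (pmf_of_set V));
          map_pmf Estimate (est xs ys)
        }
      }"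
proof -
  have "random_order V \<bind> (\<lambda>vs. iid_samples (card V) (map g (take k vs)) (s1 + s2) 0 \<bind>
        (\<lambda>xs. map_pmf Estimate (est (take s1 xs) (drop s1 xs))))
    = replicate_pmf s1 (map_pmf g (pmf_of_set V)) \<bind> (\<lambda>xs.
        replicate_pmf s2 (map_pmf g (pmf_of_set V)) \<bind> (\<lambda>ys. map_pmf Estimate (est xs ys)))"
    if "\<not> real (s1 + s2) > test_budget s r" for s1 s2
  proof -
    have le: "s1 + s2 \<le> k"
      using that unfolding assms(2) test_length_def by (intro le_nat_floor) simp
    have "iid_samples (card V) (map g (take k vs)) (s1 + s2) 0
      = map_pmf (map g) (iid_samples (card V) vs (s1 + s2) 0)" if "vs \<in> permutations_of_set V" for vs
    proof -
      have "length vs = card V"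
        using that assms(1) by (simp add: length_finite_permutations_of_set)
      then have "iid_samples (card V) (map g (take k vs)) (s1 + s2) 0
        = map_pmf (map g) (iid_samples (card V) (take k vs) (s1 + s2) 0)"
        using le assms(3) by (intro iid_samples_map) simp
      also have "iid_samples (card V) (take k vs) (s1 + s2) 0 = iid_samples (card V) vs (s1 + s2) 0"
        using le by (intro iid_samples_cong) simp
      finally show ?thesis .
    qed
    then have "random_order V \<bind> (\<lambda>vs. iid_samples (card V) (map g (take k vs)) (s1 + s2) 0)
      = map_pmf (map g) (random_order V \<bind> (\<lambda>vs. iid_samples (card V) vs (s1 + s2) 0))"
      unfolding map_bind_pmf using assms(1)
      by (intro bind_pmf_cong refl) (simp add: set_pmf_random_order)
    also have "\<dots> = replicate_pmf (s1 + s2) (map_pmf g (pmf_of_set V))"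
      using le assms(1,3) by (simp add: iid_samples_random_order map_replicate_pmf)
    finally have "random_order V \<bind> (\<lambda>vs. iid_samples (card V) (map g (take k vs)) (s1 + s2) 0 \<bind>
        (\<lambda>xs. map_pmf Estimate (est (take s1 xs) (drop s1 xs))))
      = replicate_pmf (s1 + s2) (map_pmf g (pmf_of_set V)) \<bind>
        (\<lambda>xs. map_pmf Estimate (est (take s1 xs) (drop s1 xs)))"
      by (simp flip: bind_assoc_pmf)
    also have "\<dots> = replicate_pmf s1 (map_pmf g (pmf_of_set V)) \<bind> (\<lambda>xs.
        replicate_pmf s2 (map_pmf g (pmf_of_set V)) \<bind> (\<lambda>ys. map_pmf Estimate (est xs ys)))"
      unfolding replicate_pmf_distrib bind_assoc_pmf bind_return_pmf
      by (intro bind_pmf_cong refl) (auto simp: set_replicate_pmf)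
    finally show ?thesis .
  qed
  note good = this
  \<comment> \<open>The batch sizes do not depend on the order, so they are drawn first and
    \<open>good\<close> applies to each pair of sizes within the budget.\<close>
  show ?thesis
    unfolding run_test_def
    by (subst bind_commute_pmf, intro bind_pmf_cong refl, subst bind_commute_pmf,
        intro bind_pmf_cong refl) (use good in auto)
qed

text \<open>Test and ideal estimator are coupled through the same batch sizes \<open>Q\<close>; they
  can differ only on \<open>bad\<close>, whose probability is a tail of a single Poisson
  variable.\<close>

lemma prob_test_succeeds:
  assumes "finite V" "k = test_length s r" "k \<le> card V"
  shows "measure_pmf.prob (random_order V \<bind> (\<lambda>vs. run_test (card V) s r est (map g (take k vs))))
      {res. succeeds L \<epsilon> res}
    \<ge> measure_pmf.prob (estimate_iid s est (map_pmf g (pmf_of_set V))) {x. \<bar>x - L\<bar> \<le> \<epsilon>}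
      - measure_pmf.prob (poisson (real s)) {x. real x > test_budget s r}"
proof -
  let ?p = "map_pmf g (pmf_of_set V)"
  define Q where "Q = pair_pmf (poisson (real s / 2)) (poisson (real s / 2))"
  define est' where "est' = (\<lambda>(s1, s2). replicate_pmf s1 ?p \<bind> (\<lambda>xs. replicate_pmf s2 ?p \<bind> est xs))"
  define bad where "bad = {(s1, s2). real (s1 + s2) > test_budget s r}"
  define G where "G = {x. \<bar>x - L\<bar> \<le> \<epsilon>}"
  define S where "S = {res. succeeds L \<epsilon> res}"
  define f where "f x = (if x \<in> bad then return_pmf Fail else map_pmf Estimate (est' x))" for x
  have iid: "estimate_iid s est ?p = Q \<bind> est'"
    by (simp add: estimate_iid_def Q_def est'_def pair_pmf_def bind_assoc_pmf bind_return_pmf)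
  have test: "random_order V \<bind> (\<lambda>vs. run_test (card V) s r est (map g (take k vs))) = Q \<bind> f"
    unfolding run_test_random_order[OF assms]
    by (simp add: Q_def f_def est'_def bad_def pair_pmf_def bind_assoc_pmf bind_return_pmf
        map_bind_pmf cong: if_cong)
  have vimage: "Estimate -` S = G"
    by (auto simp: S_def G_def)
  \<comment> \<open>On \<open>bad\<close> the left side is at most 0; elsewhere the two sides are
    equal.\<close>
  have le: "measure_pmf.prob (est' x) G - indicator bad x \<le> measure_pmf.prob (f x) S" for x
    using measure_pmf.prob_le_1[of "est' x" G]
    by (auto simp: f_def vimage indicator_def intro: order_trans[of _ 1])
  have "real s = real s / 2 + real s / 2"
    by simp
  then have "poisson (real s) = map_pmf (\<lambda>(s1, s2). s1 + s2) Q"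
    using poisson_add[of "real s / 2" "real s / 2"]
    by (simp add: Q_def pair_pmf_def map_bind_pmf)
  then have "measure_pmf.prob (poisson (real s)) {x. real x > test_budget s r} = measure_pmf.prob Q bad"
    by (simp add: bad_def vimage_def case_prod_unfold)
  then have "measure_pmf.prob (estimate_iid s est ?p) G
      - measure_pmf.prob (poisson (real s)) {x. real x > test_budget s r}
    = measure_pmf.expectation Q (\<lambda>x. measure_pmf.prob (est' x) G) - measure_pmf.expectation Q (indicator bad)"
    by (simp add: iid prob_bind_pmf)
  also have "\<dots> = measure_pmf.expectation Q (\<lambda>x. measure_pmf.prob (est' x) G - indicator bad x)"
    by (intro Bochner_Integration.integral_diff[symmetric] integrable_pmf_bounded[where C = 1])
       (auto simp: indicator_def)
  also have "\<dots> \<le> measure_pmf.expectation Q (\<lambda>x. measure_pmf.prob (f x) S)"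
  proof (rule expectation_mono_pmf[where C = 1 and C' = 1])
    fix x
    show "\<bar>measure_pmf.prob (est' x) G - indicator bad x\<bar> \<le> 1"
      using measure_pmf.prob_le_1[of "est' x" G] measure_nonneg[of "measure_pmf (est' x)" G]
      by (auto simp: indicator_def simp del: measure_nonneg)
  qed (use le in auto)
  also have "\<dots> = measure_pmf.prob (Q \<bind> f) S"
    by (simp add: prob_bind_pmf)
  finally show ?thesis
    by (simp add: test G_def S_def)
qed

section \<open>The baseline after a prefix handled by Mimic\<close>

text \<open>The guarantee \<open>baseline\<close> ranges over all instances with at least as many
  offline as online vertices, since the instance left after the prefix is smaller and may be
  unbalanced.\<close>

locale test_and_match_setting = mimic_setting E c Mhat pick
  for E :: "('u \<times> 'v) set" and c Mhat pick +
  fixes U :: "'u set" and V :: "'v set" and B :: "'u online_alg" and \<beta> :: real and k :: nat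
  assumes fin: "finite U" "finite V" and card_U: "card U = card V" and E: "E \<subseteq> U \<times> V"
    and k: "k \<le> card V"
    and B: "admissible B" and \<beta>: "\<beta> < 1"
    and baseline: "\<And>U' (V' :: 'v set) E'.
      \<lbrakk>finite U'; finite V'; card V' \<le> card U'; E' \<subseteq> U' \<times> V'\<rbrakk> \<Longrightarrow>
      \<beta> * real (max_matching_size E') \<le> expected_size (random_order V' \<bind> run_alg B U' E')"
begin

abbreviation late_edges :: "'v list \<Rightarrow> ('u \<times> 'v) set" where
  "late_edges vs \<equiv> E \<inter> UNIV \<times> set (drop k vs)"

lemma fin_E: "finite E"
  using E fin by (meson finite_SigmaI finite_subset)

lemma max_matching_late_le: "max_matching_size (late_edges vs) \<le> max_matching_size E"
  by (rule max_matching_size_mono[OF fin_E]) auto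

lemma matching_after_matching:
  assumes "vs \<in> permutations_of_set V" "M \<in> set_pmf (matching_after pick c Mhat B \<tau> k U E res vs)"
  shows "is_matching E M"
proof -
  have vs: "distinct vs"
    using assms(1) by (auto simp: permutations_of_set_def)
  consider "res = NoTest" | "res \<noteq> NoTest" "passes \<tau> res" | "res \<noteq> NoTest" "\<not> passes \<tau> res"
    by auto
  then show ?thesis
  proof cases
    case 1
    then show ?thesis
      using assms(2) run_alg_matching(1)[OF B vs] by (simp add: matching_after_def)
  next
    case 2
    then show ?thesis
      using assms(2) mimic_matching(1)[OF vs] by (simp add: matching_after_def)
  next
    case 3
    define M1 where "M1 = mimic pick c Mhat E (take k vs)"
    obtain M2 where M2: "M2 \<in> set_pmf (run_alg B (U - fst ` M1) E (drop k vs))" "M = M1 \<union> M2"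
      using assms(2) 3 by (auto simp: matching_after_def Let_def M1_def)
    have M2': "is_matching E M2" "snd ` M2 \<subseteq> set (drop k vs)" "fst ` M2 \<subseteq> U - fst ` M1"
      using run_alg_matching[OF B _ M2(1)] vs by auto
    have M1': "is_matching E M1" "snd ` M1 \<subseteq> set (take k vs)"
      unfolding M1_def using vs by (auto intro!: mimic_matching)
    have "set (take k vs) \<inter> set (drop k vs) = {}"
      using vs by (rule set_take_disj_set_drop_if_distinct) simp
    then show ?thesis
      unfolding M2(2) using M1' M2' by (intro is_matching_Un) blast+
  qed
qed

lemma card_matching_after_le:
  assumes "vs \<in> permutations_of_set V" "M \<in> set_pmf (matching_after pick c Mhat B \<tau> k U E res vs)"
  shows "card M \<le> max_matching_size E"
  using card_matching_le_max[OF fin_E matching_after_matching[OF assms]] .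

text \<open>Prefix and test result are fixed and only the suffix is random. The residual graph
  \<open>E'\<close> loses at most \<open>card M1\<close> from the optimum of the suffix, and the
  final matching contains \<open>M1\<close> itself.\<close>

lemma expected_size_after_prefix:
  assumes vs: "vs \<in> permutations_of_set V" and res: "res \<noteq> NoTest" "\<not> passes \<tau> res"
  shows "\<beta> * real (max_matching_size (late_edges vs))
    \<le> expected_size (random_order (set (drop k vs)) \<bind>
        (\<lambda>ws. matching_after pick c Mhat B \<tau> k U E res (take k vs @ ws)))"
proof (cases "\<beta> < 0")
  case True
  then have "\<beta> * real (max_matching_size (late_edges vs)) \<le> 0"
    by (simp add: mult_nonpos_nonneg)
  then show ?thesis
    unfolding expected_size_def by (rule order_trans) simp
next
  case False
  define M1 where "M1 = mimic pick c Mhat E (take k vs)"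
  define W where "W = set (drop k vs)"
  define E' where "E' = {e \<in> late_edges vs. fst e \<notin> fst ` M1}"
  define P where "P = random_order W \<bind> run_alg B (U - fst ` M1) E'"
  have vs': "distinct vs" "set vs = V" "length vs = card V"
    using vs fin by (auto simp: permutations_of_set_def length_finite_permutations_of_set)
  have W: "finite W" "card W = card V - k"
    using vs' by (simp_all add: W_def distinct_card)
  have disj: "set (take k vs) \<inter> W = {}"
    unfolding W_def using vs'(1) by (rule set_take_disj_set_drop_if_distinct) simp
  have M1: "is_matching E M1" "snd ` M1 \<subseteq> set (take k vs)"
    unfolding M1_def using vs'(1) by (auto intro!: mimic_matching)
  have fin_M1: "finite M1"
    using M1(1) fin_E is_matching_finite by blast
  have "card M1 \<le> card (set (take k vs))"
    using M1 by (intro card_matching_le_card_snd) auto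
  then have "card M1 \<le> k"
    using vs' k by (simp add: distinct_card)
  have card_fst: "card (fst ` M1) = card M1"
    using M1(1) by (intro card_image) (simp add: is_matching_def)
  have "fst ` M1 \<subseteq> U"
    using M1(1) E by (auto simp: is_matching_def)
  then have "card (U - fst ` M1) = card V - card M1"
    using fin_M1 card_fst card_U by (simp add: card_Diff_subset)
  \<comment> \<open>Mimic takes at most one offline vertex per arrival, so the residual instance has
    the shape that \<open>baseline\<close> asks for.\<close>
  then have "card W \<le> card (U - fst ` M1)"
    using W(2) \<open>card M1 \<le> k\<close> by simp
  moreover have "E' \<subseteq> (U - fst ` M1) \<times> W"
    using E by (force simp: E'_def W_def)
  ultimately have base: "\<beta> * real (max_matching_size E') \<le> expected_size P"
    unfolding P_def using fin(1) W(1) by (intro baseline) auto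
  have after: "random_order W \<bind> (\<lambda>ws. matching_after pick c Mhat B \<tau> k U E res (take k vs @ ws))
    = map_pmf ((\<union>) M1) P"
    unfolding P_def map_bind_pmf
  proof (intro bind_pmf_cong refl)
    fix ws assume "ws \<in> set_pmf (random_order W)"
    then have ws: "set ws = W"
      using W(1) by (auto simp: set_pmf_random_order permutations_of_set_def)
    have "run_alg B (U - fst ` M1) E ws = run_alg B (U - fst ` M1) E' ws"
      unfolding run_alg_def by (intro run_from_cong) (auto simp: nbhd_def E'_def ws W_def)
    then show "matching_after pick c Mhat B \<tau> k U E res (take k vs @ ws)
      = map_pmf ((\<union>) M1) (run_alg B (U - fst ` M1) E' ws)"
      using res vs' k by (simp add: matching_after_def Let_def M1_def)
  qed
  have P: "is_matching E' M" "snd ` M \<subseteq> W" if "M \<in> set_pmf P" for M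
  proof -
    obtain ws where "distinct ws" "set ws = W" "M \<in> set_pmf (run_alg B (U - fst ` M1) E' ws)"
      using \<open>M \<in> set_pmf P\<close> W(1) by (auto simp: P_def set_pmf_random_order permutations_of_set_def)
    then show "is_matching E' M" "snd ` M \<subseteq> W"
      using run_alg_matching[OF B] by blast+
  qed
  have fin_E': "finite E'"
    using fin_E by (simp add: E'_def)
  have "expected_size (map_pmf ((\<union>) M1) P) = measure_pmf.expectation P (\<lambda>M. real (card (M1 \<union> M)))"
    by (simp add: expected_size_def)
  also have "\<dots> = measure_pmf.expectation P (\<lambda>M. real (card M1) + real (card M))"
  proof (rule expectation_cong_pmf)
    fix M assume M: "M \<in> set_pmf P"
    have "M1 \<inter> M = {}"
      using M1(2) P(2)[OF M] disj by fastforce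
    then show "real (card (M1 \<union> M)) = real (card M1) + real (card M)"
      using fin_M1 is_matching_finite[OF fin_E' P(1)[OF M]] by (simp add: card_Un_disjoint)
  qed
  also have "\<dots> = real (card M1) + expected_size P"
    unfolding expected_size_def
    by (subst Bochner_Integration.integral_add)
       (auto intro!: integrable_pmf_bounded[where C = "real (max_matching_size E')"]
          card_matching_le_max[OF fin_E'] P)
  finally have "expected_size (map_pmf ((\<union>) M1) P) = real (card M1) + expected_size P" .
  moreover have "\<beta> * real (max_matching_size (late_edges vs))
    \<le> \<beta> * (real (max_matching_size E') + real (card M1))"
    using False max_matching_size_remove_offline[of "late_edges vs" "fst ` M1"] fin_E fin_M1 card_fst
    by (intro mult_left_mono) (auto simp: E'_def)
  \<comment> \<open>The gain of \<open>card M1\<close> edges outweighs the loss of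
    \<open>\<beta> * card M1\<close> in the guarantee.\<close>
  moreover have "\<beta> * real (card M1) \<le> 1 * real (card M1)"
    using \<beta> by (intro mult_right_mono) auto
  ultimately show ?thesis
    using base unfolding after[unfolded W_def] by (simp add: distrib_left)
qed

text \<open>Linearity of expectation over the edges of one fixed maximum matching: each has a late
  online end with probability \<open>1 - k / card V\<close>, and the edges that do form a matching
  of the suffix.\<close>

lemma expected_late_matching_ge:
  "(1 - real k / real (card V)) * real (max_matching_size E)
    \<le> measure_pmf.expectation (random_order V) (\<lambda>vs. real (max_matching_size (late_edges vs)))"
proof -
  obtain M where M: "is_matching E M" "card M = max_matching_size E"
    using max_matching_exists fin_E .
  have fin_M: "finite M"
    using is_matching_finite fin_E M(1) by blast
  have int: "integrable (measure_pmf (random_order V)) f" for f :: "'v list \<Rightarrow> real"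
    using fin by (intro integrable_measure_pmf_finite) (simp add: set_pmf_random_order)
  have "(1 - real k / real (card V)) * real (max_matching_size E)
    = (\<Sum>e\<in>M. measure_pmf.prob (random_order V) {vs. snd e \<in> set (drop k vs)})"
    using M E k fin by (subst sum.cong[OF refl prob_mem_drop_random_order])
      (auto simp: is_matching_def)
  also have "\<dots> = (\<Sum>e\<in>M. measure_pmf.expectation (random_order V)
      (indicator {vs. snd e \<in> set (drop k vs)}))"
    by simp
  also have "\<dots> = measure_pmf.expectation (random_order V)
      (\<lambda>vs. \<Sum>e\<in>M. indicator {vs. snd e \<in> set (drop k vs)} vs)"
    by (intro Bochner_Integration.integral_sum[symmetric] int)
  also have "\<dots> \<le> measure_pmf.expectation (random_order V)
      (\<lambda>vs. real (max_matching_size (late_edges vs)))"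
  proof (intro integral_mono int)
    fix vs
    have "(\<Sum>e\<in>M. indicator {vs. snd e \<in> set (drop k vs)} vs :: real)
      = real (card {e \<in> M. snd e \<in> set (drop k vs)})"
      using fin_M by (simp add: indicator_def sum.If_cases Int_def)
    also have "card {e \<in> M. snd e \<in> set (drop k vs)} \<le> max_matching_size (late_edges vs)"
      using M(1) fin_E
      by (intro card_matching_le_max is_matching_subset[OF M(1)]) (auto simp: is_matching_def)
    finally show "(\<Sum>e\<in>M. indicator {vs. snd e \<in> set (drop k vs)} vs)
      \<le> real (max_matching_size (late_edges vs))"
      by simp
  qed
  finally show ?thesis .
qed

text \<open>Here the test result is a fixed parameter and the order is averaged unconditionally.
  Redrawing the suffix makes \<open>expected_size_after_prefix\<close> applicable to every prefix;
  averaging the optimum of the suffix costs the factor \<open>1 - k / card V\<close>.\<close>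

lemma expected_size_not_passed:
  assumes "\<not> passes \<tau> res"
  shows "\<beta> * (1 - real k / real (card V)) * real (max_matching_size E)
    \<le> expected_size (random_order V \<bind> matching_after pick c Mhat B \<tau> k U E res)"
proof -
  have nonneg: "0 \<le> 1 - real k / real (card V)"
    using k by (cases "card V = 0") (simp_all add: field_simps)
  consider "\<beta> < 0" | "0 \<le> \<beta>" "res = NoTest" | "0 \<le> \<beta>" "res \<noteq> NoTest"
    by linarith
  then show ?thesis
  proof cases
    case 1
    then have "\<beta> * (1 - real k / real (card V)) * real (max_matching_size E) \<le> 0"
      using nonneg by (simp add: mult_nonpos_nonneg)
    then show ?thesis
      unfolding expected_size_def by (rule order_trans) simp
  next
    case 2
    have "\<beta> * (1 - real k / real (card V)) * real (max_matching_size E)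
      \<le> \<beta> * 1 * real (max_matching_size E)"
      using 2 by (intro mult_right_mono mult_left_mono) auto
    also have "\<dots> \<le> expected_size (random_order V \<bind> run_alg B U E)"
      using baseline[OF fin] card_U E by simp
    also have "random_order V \<bind> run_alg B U E
      = random_order V \<bind> matching_after pick c Mhat B \<tau> k U E res"
      using 2 by (intro bind_pmf_cong refl) (simp add: matching_after_def)
    finally show ?thesis .
  next
    case 3
    let ?A = "matching_after pick c Mhat B \<tau> k U E res"
    let ?P = "\<lambda>vs. random_order (set (drop k vs)) \<bind> (\<lambda>ws. ?A (take k vs @ ws))"
    have resample: "random_order V \<bind> ?A = random_order V \<bind> ?P"
      by (subst random_order_resample_suffix[OF fin(2), of k])
         (simp add: bind_assoc_pmf bind_return_pmf)
    have "\<beta> * (1 - real k / real (card V)) * real (max_matching_size E)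
      \<le> \<beta> * measure_pmf.expectation (random_order V) (\<lambda>vs. real (max_matching_size (late_edges vs)))"
      using mult_left_mono[OF expected_late_matching_ge 3(1)] by (simp add: mult.assoc)
    also have "\<dots> = measure_pmf.expectation (random_order V)
        (\<lambda>vs. \<beta> * real (max_matching_size (late_edges vs)))"
      by simp
    also have "\<dots> \<le> measure_pmf.expectation (random_order V)
        (\<lambda>vs. measure_pmf.expectation (?P vs) (\<lambda>M. real (card M)))"
      using expected_size_after_prefix[OF _ 3(2) assms] fin(2)
      by (intro integral_mono_AE integrable_measure_pmf_finite)
         (simp_all add: AE_measure_pmf_iff set_pmf_random_order expected_size_def)
    also have "\<dots> = expected_size (random_order V \<bind> ?P)"
      unfolding expected_size_def
    proof (rule expectation_bind_pmf[symmetric])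
      fix M assume "M \<in> set_pmf (random_order V \<bind> ?P)"
      then have "M \<in> set_pmf (random_order V \<bind> ?A)"
        by (simp only: resample)
      then show "\<bar>real (card M)\<bar> \<le> real (max_matching_size E)"
        using card_matching_after_le fin(2) by (auto simp: set_pmf_random_order)
    qed
    finally show ?thesis
      by (simp only: resample)
  qed
qed

text \<open>Given the prefix and the outcome of the test, the suffix is still in uniformly random order, so
  conditioning on the outcome does not spoil the guarantee of the baseline on the suffix.\<close>

lemma expected_size_conditional:
  fixes R :: "'v list \<Rightarrow> test_result pmf"
  assumes R: "(\<forall>x. R x = return_pmf NoTest) \<or> (\<forall>x. NoTest \<notin> set_pmf (R x))"
    and P: "P = do {
      vs \<leftarrow> random_order V;
      res \<leftarrow> R (take k vs);
      M \<leftarrow> matching_after pick c Mhat B \<tau> k U E res vs;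
      return_pmf (vs, res, M)
    }"
    and A: "A = {(vs, res, M). good res \<and> \<not> passes \<tau> res}" and ne: "set_pmf P \<inter> A \<noteq> {}"
  shows "\<beta> * measure_pmf.expectation (cond_pmf P A) (\<lambda>(vs, res, M). real (max_matching_size (late_edges vs)))
    \<le> measure_pmf.expectation (cond_pmf P A) (\<lambda>(vs, res, M). real (card M))"
proof -
  let ?A = "matching_after pick c Mhat B \<tau> k U E"
  \<comment> \<open>Nonnegativity of the expectation of \<open>f\<close> is the claim multiplied by
    the probability of \<open>A\<close>.\<close>
  define f where "f = (\<lambda>(vs, res, M :: ('u \<times> 'v) set). indicator A (vs, res, M) *
    (real (card M) - \<beta> * real (max_matching_size (late_edges vs))))"
  define C where "C = real (max_matching_size E) + \<bar>\<beta>\<bar> * real (max_matching_size E)"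
  have supp: "fst x \<in> permutations_of_set V \<and> snd (snd x) \<in> set_pmf (?A (fst (snd x)) (fst x))"
    if "x \<in> set_pmf P" for x
    using that fin(2) by (auto simp: P set_pmf_random_order)
  have card_le: "card (snd (snd x)) \<le> max_matching_size E" if "x \<in> set_pmf P" for x
    using supp[OF that] card_matching_after_le by blast
  have f_bound: "\<bar>f x\<bar> \<le> C" if "x \<in> set_pmf P" for x
  proof -
    obtain vs res M where x: "x = (vs, res, M)"
      by (metis prod_cases3)
    have "\<bar>f x\<bar> \<le> real (card M) + \<bar>\<beta>\<bar> * real (max_matching_size (late_edges vs))"
      by (auto simp: f_def x indicator_def abs_mult intro: order_trans[OF abs_triangle_ineq4])
    also have "\<dots> \<le> C"
      unfolding C_def using card_le[OF that] max_matching_late_le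
      by (intro add_mono mult_left_mono) (simp_all add: x)
    finally show ?thesis .
  qed
  have "0 \<le> measure_pmf.expectation P f"
  proof (cases "\<beta> < 0")
    case True
    have "0 \<le> f x" for x
      using True by (auto simp: f_def split_beta intro!: mult_nonneg_nonneg order_trans[OF mult_nonpos_nonneg])
    then show ?thesis
      by simp
  next
    case False
    show ?thesis
      using R
    proof
      assume no_test: "\<forall>x. R x = return_pmf NoTest"
      define Q where "Q = random_order V \<bind> (\<lambda>vs. map_pmf (Pair vs) (run_alg B U E vs))"
      have P_eq: "P = map_pmf (\<lambda>(vs, M). (vs, NoTest, M)) Q"
        using no_test by (simp add: P Q_def bind_return_pmf matching_after_def map_bind_pmf
          pmf.map_comp o_def flip: map_pmf_def)
      have Q: "map_pmf snd Q = random_order V \<bind> run_alg B U E"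
        by (simp add: Q_def map_bind_pmf pmf.map_comp o_def)
      have Q_card: "real (card (snd y)) \<le> real (max_matching_size E)" if "y \<in> set_pmf Q" for y
        using card_le[of "(fst y, NoTest, snd y)"] that unfolding P_eq by (force simp: split_beta)
      have "good NoTest"
        using ne no_test by (auto simp: P A)
      then have "measure_pmf.expectation P f
        = measure_pmf.expectation Q (\<lambda>y. real (card (snd y)) - \<beta> * real (max_matching_size (late_edges (fst y))))"
        by (simp add: P_eq f_def A split_beta)
      \<comment> \<open>Without a test the baseline competes with the optimum of all of
        \<open>E\<close>, which dominates that of any suffix.\<close>
      also have "\<dots> \<ge> measure_pmf.expectation Q (\<lambda>y. real (card (snd y)) - \<beta> * real (max_matching_size E))"
      proof (rule expectation_mono_pmf[where C = C and C' = C])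
        fix y assume y: "y \<in> set_pmf Q"
        have *: "\<bar>real (card (snd y)) - \<beta> * real m\<bar> \<le> C" if "m \<le> max_matching_size E" for m
        proof -
          have "\<bar>real (card (snd y)) - \<beta> * real m\<bar> \<le> real (card (snd y)) + \<bar>\<beta>\<bar> * real m"
            by (auto simp: abs_mult intro: order_trans[OF abs_triangle_ineq4])
          also have "\<dots> \<le> C"
            unfolding C_def using Q_card[OF y] that by (intro add_mono mult_left_mono) auto
          finally show ?thesis .
        qed
        show "\<bar>real (card (snd y)) - \<beta> * real (max_matching_size E)\<bar> \<le> C"
          by (rule *) simp
        show "\<bar>real (card (snd y)) - \<beta> * real (max_matching_size (late_edges (fst y)))\<bar> \<le> C"
          by (rule *[OF max_matching_late_le])
        show "real (card (snd y)) - \<beta> * real (max_matching_size E)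
          \<le> real (card (snd y)) - \<beta> * real (max_matching_size (late_edges (fst y)))"
          using False max_matching_late_le by (intro diff_left_mono mult_left_mono) auto
      qed
      also have "measure_pmf.expectation Q (\<lambda>y. real (card (snd y)) - \<beta> * real (max_matching_size E))
        = expected_size (map_pmf snd Q) - \<beta> * real (max_matching_size E)"
        unfolding expected_size_def
        by (subst Bochner_Integration.integral_diff)
           (auto intro!: integrable_pmf_bounded[where C = "real (max_matching_size E)"] dest!: Q_card)
      finally show ?thesis
        using baseline[OF fin _ E] card_U unfolding Q by simp
    next
      assume test: "\<forall>x. NoTest \<notin> set_pmf (R x)"
      define F where "F vs res = random_order (set (drop k vs)) \<bind> (\<lambda>ws.
        map_pmf (\<lambda>M. (take k vs @ ws, res, M)) (?A res (take k vs @ ws)))" for vs res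
      have "P = do {vs \<leftarrow> random_order V; ws \<leftarrow> random_order (set (drop k vs));
          res \<leftarrow> R (take k (take k vs @ ws));
          map_pmf (\<lambda>M. (take k vs @ ws, res, M)) (?A res (take k vs @ ws))}"
        unfolding P by (subst random_order_resample_suffix[OF fin(2), of k])
          (simp add: bind_assoc_pmf bind_return_pmf map_pmf_def)
      \<comment> \<open>The prefix has length exactly \<open>k\<close>, so the test does not see the
        redrawn \<open>ws\<close> and can be moved in front of it.\<close>
      also have "\<dots> = do {vs \<leftarrow> random_order V; ws \<leftarrow> random_order (set (drop k vs));
          res \<leftarrow> R (take k vs);
          map_pmf (\<lambda>M. (take k vs @ ws, res, M)) (?A res (take k vs @ ws))}"
        using fin(2) k
        by (intro bind_pmf_cong refl) (auto simp: set_pmf_random_order length_finite_permutations_of_set)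
      also have "\<dots> = random_order V \<bind> (\<lambda>vs. R (take k vs) \<bind> F vs)"
        unfolding F_def by (intro bind_pmf_cong refl bind_commute_pmf)
      finally have P_eq: "P = random_order V \<bind> (\<lambda>vs. R (take k vs) \<bind> F vs)" .
      have bound: "\<bar>f y\<bar> \<le> C" if "vs \<in> set_pmf (random_order V)" "res \<in> set_pmf (R (take k vs))"
        "y \<in> set_pmf (F vs res)" for vs res y
        using that by (intro f_bound) (auto simp: P_eq)
      show ?thesis
        unfolding P_eq
      proof (intro expectation_bind_nonneg[where C = C])
        fix vs res assume vs: "vs \<in> set_pmf (random_order V)" and res: "res \<in> set_pmf (R (take k vs))"
        have "res \<noteq> NoTest"
          using res test by auto
        have vs_perm: "vs \<in> permutations_of_set V"
          using vs fin(2) by (simp add: set_pmf_random_order)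
        then have len: "length (take k vs) = k"
          using k fin(2) by (simp add: length_finite_permutations_of_set)
        show "0 \<le> measure_pmf.expectation (F vs res) f"
        \<comment> \<open>Membership in \<open>A\<close> depends on \<open>res\<close> alone, so it
          is constant once prefix and result are fixed; \<open>late_edges\<close> is constant too,
          since \<open>ws\<close> reorders the same set of arrivals.\<close>
        proof (cases "good res \<and> \<not> passes \<tau> res")
          case True
          let ?P = "random_order (set (drop k vs)) \<bind> (\<lambda>ws. ?A res (take k vs @ ws))"
          have F_card: "card (snd (snd x)) \<le> max_matching_size E" if "x \<in> set_pmf (F vs res)" for x
            using that vs res by (intro card_le) (auto simp: P_eq)
          have snd_F: "map_pmf (\<lambda>x. snd (snd x)) (F vs res) = ?P"
            by (simp add: F_def map_bind_pmf pmf.map_comp o_def)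
          have "measure_pmf.expectation (F vs res) f
            = measure_pmf.expectation (F vs res)
                (\<lambda>x. real (card (snd (snd x))) - \<beta> * real (max_matching_size (late_edges vs)))"
          proof (rule expectation_cong_pmf)
            fix x assume "x \<in> set_pmf (F vs res)"
            then obtain ws M where ws: "set ws = set (drop k vs)" and x: "x = (take k vs @ ws, res, M)"
              by (auto simp: F_def set_pmf_random_order permutations_of_set_def)
            show "f x = real (card (snd (snd x))) - \<beta> * real (max_matching_size (late_edges vs))"
              using True ws len by (simp add: f_def x A)
          qed
          also have "\<dots> = expected_size (map_pmf (\<lambda>x. snd (snd x)) (F vs res))
              - \<beta> * real (max_matching_size (late_edges vs))"
            unfolding expected_size_def
            by (subst Bochner_Integration.integral_diff)
               (auto intro!: integrable_pmf_bounded[where C = "real (max_matching_size E)"] dest!: F_card)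
          also have "\<dots> \<ge> 0"
            unfolding snd_F using expected_size_after_prefix[OF vs_perm \<open>res \<noteq> NoTest\<close>] True by simp
          finally show ?thesis .
        next
          case False
          have "measure_pmf.expectation (F vs res) f = measure_pmf.expectation (F vs res) (\<lambda>_. 0)"
            using False by (intro expectation_cong_pmf) (auto simp: F_def f_def A)
          then show ?thesis
            by simp
        qed
      qed (use bound in auto)
    qed
  qed
  also have "measure_pmf.expectation P f
    = measure_pmf.expectation P (\<lambda>x. indicator A x * real (card (snd (snd x))))
      - \<beta> * measure_pmf.expectation P (\<lambda>x. indicator A x * real (max_matching_size (late_edges (fst x))))"
  proof -
    have "measure_pmf.expectation P f = measure_pmf.expectation P
      (\<lambda>x. indicator A x * real (card (snd (snd x)))
        - \<beta> * (indicator A x * real (max_matching_size (late_edges (fst x)))))"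
      by (intro expectation_cong_pmf) (auto simp: f_def algebra_simps)
    also have "\<dots> = measure_pmf.expectation P (\<lambda>x. indicator A x * real (card (snd (snd x))))
      - measure_pmf.expectation P (\<lambda>x. \<beta> * (indicator A x * real (max_matching_size (late_edges (fst x)))))"
      by (intro Bochner_Integration.integral_diff integrable_mult_right
            integrable_pmf_bounded[where C = "real (max_matching_size E)"])
         (use card_le max_matching_late_le in \<open>auto simp: indicator_def\<close>)
    finally show ?thesis
      by simp
  qed
  finally show ?thesis
    unfolding expectation_cond_pmf[OF ne] split_beta times_divide_eq_right
    by (intro divide_right_mono) auto
qed

end

section \<open>Guarantees of TestAndMatch\<close>

text \<open>The second case appears in two forms: for a fixed result, averaged over all orders, and
  conditioned on \<open>Case2\<close>. In the conditional form the benchmark is the optimum of the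
  suffix, because conditioning may bias which vertices arrive late.\<close>

theorem theorem4p1:
  fixes U :: "'u set" and V :: "'v set" and E :: "('u \<times> 'v) set"
    and c :: "'u set \<Rightarrow> nat"
    and Mhat :: "('u \<times> ('u set \<times> nat)) set"
    and pick :: "'u set list \<Rightarrow> ('u set \<times> nat) set \<Rightarrow> 'u set \<times> nat"
    and B :: "'u online_alg"
    and S :: "nat \<Rightarrow> real \<Rightarrow> real \<Rightarrow> nat"
    and est :: "'u set option estimator"
    and P :: "real poly" and \<delta>poi :: "nat \<Rightarrow> real"
    and n r k s nhat nstar :: nat
    and \<beta> \<epsilon> \<delta> \<delta>' \<tau> L :: real
    and TAM :: "('v list \<times> test_result \<times> ('u \<times> 'v) set) pmf"
    and Case2 :: "('v list \<times> test_result \<times> ('u \<times> 'v) set) set"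
  assumes "finite U" and "finite V" and "card U = n" and "card V = n" and "0 < n"
    and "E \<subseteq> U \<times> V"
    and "nstar = max_matching_size E"
    and "\<And>t. \<not> t \<subseteq> U \<Longrightarrow> c t = 0" and "(\<Sum>t\<in>Pow U. c t) = n"
    and "r = card (advice_support c)"
    and "is_max_matching (advice_edges c) Mhat" and "nhat = card Mhat"
    and "\<And>h C. C \<noteq> {} \<Longrightarrow> pick h C \<in> C"
    and "admissible B" and "\<beta> < 1"
    and baseline_ratio: "\<And>U' (V' :: 'v set) E'.
      \<lbrakk>finite U'; finite V'; card V' \<le> card U'; E' \<subseteq> U' \<times> V'\<rbrakk> \<Longrightarrow>
      \<beta> * real (max_matching_size E') \<le> expected_size (random_order V' \<bind> run_alg B U' E')"
    and "L1_estimator S est"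
    and "0 < \<epsilon>" and "0 < \<delta>'"
    and "0 < degree P" and "\<And>i::nat. 1 \<le> i \<Longrightarrow> 0 < poly P (real i)"
    and "\<delta>poi \<in> O(\<lambda>i. 1 / poly P (real i))"
    and "\<And>i. 1 \<le> i \<Longrightarrow>
      measure_pmf.prob (poisson (real (S (i + 1) \<epsilon> \<delta>')))
        {x. real x > test_budget (S (i + 1) \<epsilon> \<delta>') i} \<le> \<delta>poi i"
    and "\<delta> > 1 / poly P (real r)" and "\<delta> = \<delta>' + \<delta>poi r"
    and "s = S (r + 1) \<epsilon> \<delta>'"
    and "k = test_length s r" and "k \<le> n"
    and "\<tau> = threshold nhat n \<beta> \<epsilon>"
    and "L = L1 (Pow U) (\<lambda>t. real (type_count E V t) / real n) (\<lambda>t. real (c t) / real n)"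
    and "TAM = test_and_match pick c Mhat B \<beta> \<epsilon> s
      (est (test_domain c) (test_dist c n) \<epsilon> \<delta>') U V E"
    and "Case2 = {(vs, res, M). succeeds L \<epsilon> res \<and> \<not> passes \<tau> res}"
  shows "measure_pmf.prob TAM {(vs, res, M). succeeds L \<epsilon> res} \<ge> 1 - \<delta> \<and>
    (\<forall>(vs, res, M) \<in> set_pmf TAM. succeeds L \<epsilon> res \<longrightarrow>
      is_matching E M \<and>
      (if passes \<tau> res
       then real (card M) / real nstar \<ge> real nhat / real n - L / 2 \<and>
            real nhat / real n - L / 2 \<ge> \<beta>
       else expected_size (random_order V \<bind> matching_after pick c Mhat B \<tau> k U E res)
            \<ge> \<beta> * (1 - real k / real n) * real nstar)) \<and>
    (set_pmf TAM \<inter> Case2 \<noteq> {} \<longrightarrow>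
      measure_pmf.expectation (cond_pmf TAM Case2) (\<lambda>(vs, res, M). real (card M))
      \<ge> \<beta> * measure_pmf.expectation (cond_pmf TAM Case2)
              (\<lambda>(vs, res, M). real (max_matching_size (E \<inter> UNIV \<times> set (drop k vs)))))"
proof -
  have n: "card V = n" "card U = card V" "0 < card V" "V \<noteq> {}"
    using assms by auto
  interpret test_and_match_setting E c Mhat pick U V B \<beta> k
    using assms by unfold_locales (auto simp: is_max_matching_def)
  define A where "A = advice_support c"
  have A_sub: "A \<subseteq> Pow U"
    using assms(8) by (force simp: A_def advice_support_def)
  have fin_A: "finite A"
    using A_sub fin(1) by (meson finite_Pow_iff finite_subset)
  \<comment> \<open>This gives \<open>1 \<le> r\<close>, so the test domain has at least two
    elements and the Poisson tail bound is available at \<open>r\<close>.\<close>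
  have "A \<noteq> {}"
  proof
    assume "A = {}"
    then have "(\<Sum>t\<in>Pow U. c t) = 0"
      by (auto simp: A_def advice_support_def)
    then show False
      using assms(5,9) by simp
  qed
  then have r: "1 \<le> r"
    using fin_A by (simp add: assms(10) A_def card_gt_0_iff Suc_le_eq)
  let ?R = "\<lambda>vs. if real nhat / real n \<le> \<beta> then return_pmf NoTest
    else run_test n s r (est (test_domain c) (test_dist c n) \<epsilon> \<delta>') (map (\<lambda>v. relabel c (nbhd E v)) vs)"
  have TAM: "TAM = do {
      vs \<leftarrow> random_order V;
      res \<leftarrow> ?R (take k vs);
      M \<leftarrow> matching_after pick c Mhat B \<tau> k U E res vs;
      return_pmf (vs, res, M)
    }"
    using assms by (simp add: test_and_match_def Let_def cong: if_cong)
  have no_NoTest: "NoTest \<notin> set_pmf (run_test m s r e X)" for m e and X :: "'u set option list"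
    by (auto simp: run_test_def)
  have \<delta>poi: "measure_pmf.prob (poisson (real s)) {x. real x > test_budget s r} \<le> \<delta>poi r"
    using assms(23)[OF r] assms(26) by simp
  have "measure_pmf.prob TAM {(vs, res, M). succeeds L \<epsilon> res} \<ge> 1 - \<delta>"
  proof -
    define D where "D = test_domain c"
    have D: "finite D" "card D = r + 1"
      unfolding D_def test_domain_def using fin_A by (simp_all add: A_def card_image assms(10))
    let ?g = "\<lambda>v. relabel c (nbhd E v)"
    let ?S = "{res. succeeds L \<epsilon> res}"
    have "measure_pmf.prob TAM {(vs, res, M). succeeds L \<epsilon> res}
      = measure_pmf.prob (map_pmf (\<lambda>(vs, res, M). res) TAM) ?S"
      by (simp add: vimage_def case_prod_unfold)
    also have "map_pmf (\<lambda>(vs, res, M). res) TAM = random_order V \<bind> (\<lambda>vs. ?R (take k vs))"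
      unfolding TAM by (simp add: map_bind_pmf bind_return_pmf')
    finally have prob: "measure_pmf.prob TAM {(vs, res, M). succeeds L \<epsilon> res}
      = measure_pmf.prob (random_order V \<bind> (\<lambda>vs. ?R (take k vs))) ?S" .
    have "0 \<le> \<delta>poi r"
      using \<delta>poi measure_nonneg order_trans by blast
    show ?thesis
    \<comment> \<open>Without a test success is certain; for \<open>1 \<le> \<delta>'\<close>,
      outside the range of the estimator guarantee, the claimed bound is at most 0.\<close>
    proof (cases "real nhat / real n \<le> \<beta> \<or> 1 \<le> \<delta>'")
      case True
      then show ?thesis
      proof
        assume "real nhat / real n \<le> \<beta>"
        then have "measure_pmf.prob (random_order V \<bind> (\<lambda>vs. ?R (take k vs))) ?S = 1"
          by simp
        then show ?thesis
          using \<open>0 \<le> \<delta>poi r\<close> assms(19,25) unfolding prob by simp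
      next
        assume "1 \<le> \<delta>'"
        then have "1 - \<delta> \<le> 0"
          using \<open>0 \<le> \<delta>poi r\<close> assms(25) by simp
        then show ?thesis
          by (rule order_trans) simp
      qed
    next
      case False
      obtain C where C: "\<And>(D :: 'u set option set) q \<epsilon> \<delta>. finite D \<and> 2 \<le> card D \<and> (\<forall>t\<in>D. 0 \<le> q t) \<and> sum q D = 1 \<and>
          0 < \<epsilon> \<and> 0 < \<delta> \<and> \<delta> < 1 \<Longrightarrow>
          (\<forall>p. set_pmf p \<subseteq> D \<longrightarrow>
           measure_pmf.prob (estimate_iid (S (card D) \<epsilon> \<delta>) (est D q \<epsilon> \<delta>) p)
             {L. \<bar>L - L1 D (pmf p) q\<bar> \<le> \<epsilon>} \<ge> 1 - \<delta>)"
        using assms(17) unfolding L1_estimator_def by blast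
      have "sum (test_dist c n) D = (\<Sum>t\<in>A. real (c t) / real n)"
        unfolding D_def test_domain_def using fin_A
        by (subst sum.insert) (auto simp: A_def test_dist_def sum.reindex)
      also have "\<dots> = real (\<Sum>t\<in>A. c t) / real n"
        by (simp add: sum_divide_distrib)
      also have "(\<Sum>t\<in>A. c t) = (\<Sum>t\<in>Pow U. c t)"
        using A_sub fin(1) by (intro sum.mono_neutral_left) (auto simp: A_def advice_support_def)
      finally have sum_q: "sum (test_dist c n) D = 1"
        using assms(5,9) by simp
      have q: "0 \<le> test_dist c n t" for t
        by (simp add: test_dist_def split: option.split)
      have p: "set_pmf (map_pmf ?g (pmf_of_set V)) \<subseteq> D"
        by (auto simp: D_def test_domain_def relabel_def)
      have L: "L1 D (pmf (map_pmf ?g (pmf_of_set V))) (test_dist c n) = L"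
        unfolding D_def assms(30) n(1)[symmetric]
        using fin E n(4) assms(8) by (intro L1_test_domain)
      have "1 - \<delta>' \<le> measure_pmf.prob (estimate_iid (S (card D) \<epsilon> \<delta>') (est D (test_dist c n) \<epsilon> \<delta>')
          (map_pmf ?g (pmf_of_set V))) {x. \<bar>x - L1 D (pmf (map_pmf ?g (pmf_of_set V))) (test_dist c n)\<bar> \<le> \<epsilon>}"
        using C[of D "test_dist c n" \<epsilon> \<delta>'] D r sum_q q p assms(18,19) False by auto
      then have est: "1 - \<delta>' \<le> measure_pmf.prob (estimate_iid s (est D (test_dist c n) \<epsilon> \<delta>')
          (map_pmf ?g (pmf_of_set V))) {x. \<bar>x - L\<bar> \<le> \<epsilon>}"
        unfolding L D(2) assms(26) .
      have "1 - \<delta> \<le> measure_pmf.prob (estimate_iid s (est D (test_dist c n) \<epsilon> \<delta>')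
          (map_pmf ?g (pmf_of_set V))) {x. \<bar>x - L\<bar> \<le> \<epsilon>}
        - measure_pmf.prob (poisson (real s)) {x. real x > test_budget s r}"
        using est \<delta>poi assms(25) by linarith
      also have "\<dots> \<le> measure_pmf.prob (random_order V \<bind> (\<lambda>vs. run_test (card V) s r
          (est D (test_dist c n) \<epsilon> \<delta>') (map ?g (take k vs)))) ?S"
        using fin(2) assms(27) k by (rule prob_test_succeeds)
      finally show ?thesis
        using False unfolding prob by (simp add: D_def n(1))
    qed
  qed
  moreover have "is_matching E M \<and>
      (if passes \<tau> res
       then real (card M) / real nstar \<ge> real nhat / real n - L / 2 \<and> real nhat / real n - L / 2 \<ge> \<beta>
       else expected_size (random_order V \<bind> matching_after pick c Mhat B \<tau> k U E res)
            \<ge> \<beta> * (1 - real k / real n) * real nstar)"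
    if "(vs, res, M) \<in> set_pmf TAM" "succeeds L \<epsilon> res" for vs res M
  proof -
    have vs: "vs \<in> permutations_of_set V" and M: "M \<in> set_pmf (matching_after pick c Mhat B \<tau> k U E res vs)"
      using that(1) fin(2) by (auto simp: TAM set_pmf_random_order)
    have "is_matching E M"
      using matching_after_matching[OF vs M] .
    moreover have "real (card M) / real nstar \<ge> real nhat / real n - L / 2 \<and> real nhat / real n - L / 2 \<ge> \<beta>"
      if "passes \<tau> res"
    proof
      obtain L' where res: "res = Estimate L'" and L': "L' \<le> \<tau>"
        using \<open>passes \<tau> res\<close> by (cases res) auto
      have M: "M = mimic pick c Mhat E vs"
        using M that by (simp add: matching_after_def res)
      have "\<bar>L' - L\<bar> \<le> \<epsilon>"
        using \<open>succeeds L \<epsilon> res\<close> by (simp add: res)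
      \<comment> \<open>\<open>L \<le> L' + \<epsilon> \<le> \<tau> + \<epsilon> = 2 * (nhat / n -
        \<beta>)\<close>: the shift by \<open>\<epsilon>\<close> in the threshold absorbs the
        estimation error.\<close>
      then show "\<beta> \<le> real nhat / real n - L / 2"
        using L' unfolding assms(29) threshold_def by argo
      have "real (card M) \<ge> real nhat - real n * L / 2"
        unfolding M assms(12) n(1)[symmetric]
        by (rule card_mimic_ge[OF fin(1) assms(8) _ fin(2) E vs]) (use assms in auto)
      then have "(real nhat - real n * L / 2) / real n \<le> real (card M) / real n"
        by (rule divide_right_mono) simp
      then have ge: "real nhat / real n - L / 2 \<le> real (card M) / real n"
        using n by (simp add: diff_divide_distrib)
      have "card M \<le> nstar"
        using card_matching_le_max[OF fin_E \<open>is_matching E M\<close>] assms(7) by simp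
      moreover have "nstar \<le> n"
        unfolding assms(7) n(1)[symmetric]
        using E by (intro max_matching_size_le_card fin(2) fin_E) auto
      \<comment> \<open>For \<open>nstar = 0\<close> also \<open>card M = 0\<close>, and both
        quotients are 0.\<close>
      ultimately have "real (card M) / real n \<le> real (card M) / real nstar"
        by (cases "nstar = 0") (auto intro!: divide_left_mono)
      then show "real nhat / real n - L / 2 \<le> real (card M) / real nstar"
        using ge by linarith
    qed
    moreover have "expected_size (random_order V \<bind> matching_after pick c Mhat B \<tau> k U E res)
      \<ge> \<beta> * (1 - real k / real n) * real nstar" if "\<not> passes \<tau> res"
      using expected_size_not_passed[OF that] by (simp add: assms(7) n(1))
    ultimately show ?thesis
      by simp
  qed
  moreover have "measure_pmf.expectation (cond_pmf TAM Case2) (\<lambda>(vs, res, M). real (card M))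
      \<ge> \<beta> * measure_pmf.expectation (cond_pmf TAM Case2)
              (\<lambda>(vs, res, M). real (max_matching_size (E \<inter> UNIV \<times> set (drop k vs))))"
    if "set_pmf TAM \<inter> Case2 \<noteq> {}"
    using no_NoTest by (intro expected_size_conditional[OF _ TAM assms(32) that]) auto
  ultimately show ?thesis
    by auto
qed

end
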